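(* Let $\Omega\subset\mathbb{R}^n$, $n\le 3$, be a bounded domain with $C^{3,1}$-boundary, let $a,c,d\ge 0$ and $b>0$ be constants, and let $T>0$. Let $(v,h)$ be a sufficiently smooth solution on $[0,T]$ of $$v_t+\nabla h=0,\qquad (1-ah)\,h_t+\operatorname{div} v=b\,\Delta h-c\,v\cdot\nabla h-d\,h\operatorname{div} v\quad\text{in }\Omega,$$ $$h=0\ \text{ on }\partial\Omega,\qquad h(0)=h_0,\quad v(0)=v_0\ \text{ in }\Omega.$$ Then for all $w\in L^2(\Omega)^n$ and $q\in H^1_0(\Omega)$, and all $0\le t\le T$, $$(v_t,w)_\Omega+(\nabla h,w)_\Omega=0,$$ $$((1-ah)h_t,q)_\Omega-(v,\nabla q)_\Omega=-b(\nabla h,\nabla q)_\Omega-(c-d)(v\cdot\nabla h,q)_\Omega+d(h,v\cdot\nabla q)_\Omega.$$ Moreover, $$\frac{\mathrm{d}}{\mathrm{d}t}\mathcal{H}(v,h)=-b\,\|\nabla h\|_{L^2}^2+(2d-c)\,(v\cdot\nabla h,h)_\Omega .$$ For $c=2d$, the energy $\mathcal{H}(v(t),h(t))$ thus decreases monotonically (i.e. is non-increasing) over time.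
   Context: The unknowns are $v:\Omega\times[0,T]\to\mathbb{R}^n$ and $h:\Omega\times[0,T]\to\mathbb{R}$; the subscript $t$ denotes the time derivative. $(f,g)_\Omega=\int_\Omega f\,g\,\mathrm{d}x$ denotes the $L^2(\Omega)$ scalar product (of scalar- or vector-valued functions). The Hamiltonian (total energy) is $$\mathcal{H}(v,h):=\int_\Omega \tfrac12|v|^2+\tfrac12h^2-\tfrac a3h^3\,\mathrm{d}x .$$ "Sufficiently smooth" means that all derivatives appearing in the equations exist and are regular enough for integration by parts over $\Omega$ and differentiation of $\mathcal{H}$ under the integral to be justified. *)

theory Defs
  imports "HOL-Analysis.Analysis"
begin

section \<open>Differential operators\<close>

definition partial :: "'n::finite \<Rightarrow> (real^'n \<Rightarrow> real) \<Rightarrow> real^'n \<Rightarrow> real" where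
  "partial i f x = frechet_derivative f (at x) (axis i 1)"

definition grad :: "(real^'n::finite \<Rightarrow> real) \<Rightarrow> real^'n \<Rightarrow> real^'n" where
  "grad f x = (\<chi> i. partial i f x)"

definition divergence :: "(real^'n::finite \<Rightarrow> real^'n) \<Rightarrow> real^'n \<Rightarrow> real" where
  "divergence v x = (\<Sum>i\<in>UNIV. partial i (\<lambda>y. v y $ i) x)"

definition laplacian :: "(real^'n::finite \<Rightarrow> real) \<Rightarrow> real^'n \<Rightarrow> real" where
  "laplacian f x = (\<Sum>i\<in>UNIV. partial i (partial i f) x)"

text \<open>Time-dependent functions take the time argument first.  The derivative is taken within
  \<open>{0..T}\<close>, so it is one-sided at the two end points.\<close>

definition time_deriv ::
    "real \<Rightarrow> (real \<Rightarrow> 'x \<Rightarrow> 'b::real_normed_vector) \<Rightarrow> real \<Rightarrow> 'x \<Rightarrow> 'b" where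
  "time_deriv T u t x = vector_derivative (\<lambda>s. u s x) (at t within {0..T})"


section \<open>Classes of differentiable functions and \<open>C\<^sup>k\<^sup>,\<^sup>1\<close> boundaries\<close>

text \<open>Both predicates are meant for open \<open>U\<close>.\<close>

primrec C_k_on :: "nat \<Rightarrow> (real^'n::finite) set \<Rightarrow> (real^'n \<Rightarrow> real) \<Rightarrow> bool" where
  "C_k_on 0 U f \<longleftrightarrow> continuous_on U f"
| "C_k_on (Suc k) U f \<longleftrightarrow> f differentiable_on U \<and> (\<forall>i. C_k_on k U (partial i f))"

primrec C_k1_on :: "nat \<Rightarrow> (real^'n::finite) set \<Rightarrow> (real^'n \<Rightarrow> real) \<Rightarrow> bool" where
  "C_k1_on 0 U f \<longleftrightarrow> (\<exists>L. L-lipschitz_on U f)"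
| "C_k1_on (Suc k) U f \<longleftrightarrow> f differentiable_on U \<and> (\<forall>i. C_k1_on k U (partial i f))"

text \<open>Near each boundary point the set lies strictly above the graph of a \<open>C\<^sup>k\<^sup>,\<^sup>1\<close> function of
  the \<open>n - 1\<close> coordinates orthogonal to a unit vector \<open>e\<close>.  Such a function is represented by a
  function \<open>\<gamma>\<close> on the whole space that is constant along the direction \<open>e\<close>.\<close>

definition C_k1_boundary :: "nat \<Rightarrow> (real^'n::finite) set \<Rightarrow> bool" where
  "C_k1_boundary k \<Omega> \<longleftrightarrow>
     (\<forall>x0\<in>frontier \<Omega>. \<exists>r>0. \<exists>e \<gamma>. norm e = 1
        \<and> (\<forall>x s. \<gamma> (x + s *\<^sub>R e) = \<gamma> x)
        \<and> C_k1_on k (ball x0 r) \<gamma>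
        \<and> \<Omega> \<inter> ball x0 r = {x \<in> ball x0 r. \<gamma> x < x \<bullet> e})"

definition bounded_domain :: "(real^'n::finite) set \<Rightarrow> bool" where
  "bounded_domain \<Omega> \<longleftrightarrow> open \<Omega> \<and> connected \<Omega> \<and> \<Omega> \<noteq> {} \<and> bounded \<Omega>"


section \<open>The spaces \<open>L\<^sup>2\<close>, \<open>H\<^sup>1\<close> and \<open>H\<^sup>1\<^sub>0\<close>\<close>

definition L2 :: "(real^'n::finite) set \<Rightarrow> (real^'n \<Rightarrow> 'b::euclidean_space) set" where
  "L2 \<Omega> = {f. f \<in> borel_measurable (lebesgue_on \<Omega>)
              \<and> integrable (lebesgue_on \<Omega>) (\<lambda>x. (norm (f x))\<^sup>2)}"

definition L2_inner ::
    "(real^'n::finite) set \<Rightarrow> (real^'n \<Rightarrow> 'b::euclidean_space) \<Rightarrow> (real^'n \<Rightarrow> 'b) \<Rightarrow> real" where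
  "L2_inner \<Omega> f g = (LINT x|lebesgue_on \<Omega>. f x \<bullet> g x)"

definition L2_norm :: "(real^'n::finite) set \<Rightarrow> (real^'n \<Rightarrow> 'b::euclidean_space) \<Rightarrow> real" where
  "L2_norm \<Omega> f = sqrt (L2_inner \<Omega> f f)"

definition test_functions :: "(real^'n::finite) set \<Rightarrow> (real^'n \<Rightarrow> real) set" where
  "test_functions \<Omega> = {\<phi>. (\<forall>k. C_k_on k UNIV \<phi>)
      \<and> compact (closure {x. \<phi> x \<noteq> 0}) \<and> closure {x. \<phi> x \<noteq> 0} \<subseteq> \<Omega>}"

text \<open>Elements of \<open>H\<^sup>1\<close> and \<open>H\<^sup>1\<^sub>0\<close> are presented together with a representative \<open>Dq\<close> of their weak
  gradient, which is unique up to null sets: \<open>H1 \<Omega> q Dq\<close> says that \<open>q\<close> belongs to \<open>H\<^sup>1(\<Omega>)\<close> and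
  has weak gradient \<open>Dq\<close>.\<close>

definition H1 :: "(real^'n::finite) set \<Rightarrow> (real^'n \<Rightarrow> real) \<Rightarrow> (real^'n \<Rightarrow> real^'n) \<Rightarrow> bool" where
  "H1 \<Omega> q Dq \<longleftrightarrow> q \<in> L2 \<Omega> \<and> Dq \<in> L2 \<Omega>
     \<and> (\<forall>\<phi>\<in>test_functions \<Omega>. \<forall>i.
          (LINT x|lebesgue_on \<Omega>. q x * partial i \<phi> x) = - (LINT x|lebesgue_on \<Omega>. Dq x $ i * \<phi> x))"

text \<open>\<open>H\<^sup>1\<^sub>0(\<Omega>)\<close> is the closure of the test functions with respect to the \<open>H\<^sup>1\<close> norm.\<close>

definition H10 :: "(real^'n::finite) set \<Rightarrow> (real^'n \<Rightarrow> real) \<Rightarrow> (real^'n \<Rightarrow> real^'n) \<Rightarrow> bool" where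
  "H10 \<Omega> q Dq \<longleftrightarrow> H1 \<Omega> q Dq
     \<and> (\<exists>\<phi>. (\<forall>k::nat. \<phi> k \<in> test_functions \<Omega>)
          \<and> (\<lambda>k. sqrt ((L2_norm \<Omega> (\<lambda>x. \<phi> k x - q x))\<^sup>2
                        + (L2_norm \<Omega> (\<lambda>x. grad (\<phi> k) x - Dq x))\<^sup>2)) \<longlonglongrightarrow> 0)"


section \<open>The Hamiltonian and the regularity of solutions\<close>

definition hamiltonian ::
    "(real^'n::finite) set \<Rightarrow> real \<Rightarrow> (real^'n \<Rightarrow> real^'n) \<Rightarrow> (real^'n \<Rightarrow> real) \<Rightarrow> real" where
  "hamiltonian \<Omega> a v h =
     (LINT x|lebesgue_on \<Omega>. 1/2 * (norm (v x))\<^sup>2 + 1/2 * (h x)\<^sup>2 - a/3 * (h x)^3)"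

text \<open>Classical regularity: \<open>v\<close> and \<open>h\<close> are continuous up to the boundary, all derivatives
  occurring in the system exist pointwise in \<open>\<Omega>\<close>, and these derivatives have a common
  square-integrable majorant that does not depend on time.  On a bounded domain this class contains
  all \<open>(v, h)\<close> for which \<open>v\<close>, \<open>h\<close> and the derivatives \<open>v\<^sub>t\<close>, \<open>h\<^sub>t\<close>, \<open>\<nabla>v\<close>, \<open>\<nabla>h\<close>, \<open>\<nabla>\<^sup>2h\<close> are
  continuous on \<open>\<Omega> \<times> [0,T]\<close> and extend continuously to \<open>closure \<Omega> \<times> [0,T]\<close>.\<close>

definition sufficiently_smooth ::
    "(real^'n::finite) set \<Rightarrow> real \<Rightarrow> (real \<Rightarrow> real^'n \<Rightarrow> real^'n) \<Rightarrow> (real \<Rightarrow> real^'n \<Rightarrow> real) \<Rightarrow> bool" where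
  "sufficiently_smooth \<Omega> T v h \<longleftrightarrow>
     continuous_on ({0..T} \<times> closure \<Omega>) (\<lambda>(t, x). v t x)
   \<and> continuous_on ({0..T} \<times> closure \<Omega>) (\<lambda>(t, x). h t x)
   \<and> (\<forall>t\<in>{0..T}. (\<forall>i. C_k_on 1 \<Omega> (\<lambda>x. v t x $ i)) \<and> C_k_on 2 \<Omega> (h t))
   \<and> (\<forall>t\<in>{0..T}. \<forall>x\<in>\<Omega>. (\<lambda>s. v s x) differentiable (at t within {0..T})
                        \<and> (\<lambda>s. h s x) differentiable (at t within {0..T}))
   \<and> (\<exists>G::real^'n \<Rightarrow> real. G \<in> L2 \<Omega> \<and> (\<forall>t\<in>{0..T}. \<forall>x\<in>\<Omega>.
          norm (time_deriv T v t x) \<le> G x \<and> \<bar>time_deriv T h t x\<bar> \<le> G x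
        \<and> norm (grad (h t) x) \<le> G x \<and> \<bar>divergence (v t) x\<bar> \<le> G x \<and> \<bar>laplacian (h t) x\<bar> \<le> G x))"

end

theory Submission
  imports Defs
begin

text \<open>The weak form is obtained by integrating by parts against \<open>C\<^sup>1\<close> functions with compact support
  in \<open>\<Omega>\<close>, where no boundary regularity enters, for the three fields \<open>v\<close>, \<open>\<nabla>h\<close> and \<open>h v\<close>, and passing
  to the limit in \<open>H\<^sup>1\<close>.  The energy balance is the weak form tested with \<open>q = h\<close>.  That \<open>h\<close> is
  admissible follows from its continuity up to the boundary: a \<open>C\<^sup>1\<close> truncation of the values of \<open>h\<close>
  near \<open>0\<close> has compact support in \<open>\<Omega>\<close>, and these truncations converge to \<open>h\<close> in \<open>H\<^sup>1\<close> because
  \<open>\<nabla>h = 0\<close> almost everywhere on the zero set of \<open>h\<close>.\<close>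

section \<open>Partial derivatives and \<open>C\<^sup>1\<close> functions\<close>

text \<open>The majorant controls \<open>grad h\<close>, \<open>divergence v\<close> and
  \<open>laplacian h\<close> in \<open>L\<^sup>2\<close>, but neither the single derivatives of v
  nor the single second derivatives of h, and it gives no pointwise bound near the boundary. Hence
  single derivatives are paired only with compactly supported factors, and limits are taken after
  they have been summed to a divergence. The factor \<open>1 - a * h\<close> may vanish, so the
  second equation is never divided by it. The energy does not ask for that: the derivative of its
  cubic term turns h h_t into (1 - a h) h_t h, the left side of the equation tested with h. The
  coefficient 2d - c has two sources. Integrating the product h v by parts as a whole produces d (v
  . grad h, q) besides d (h, v . grad q), and for q = h these are the same integral.\<close>

lemma partial_eqI:
  assumes "(f has_derivative f') (at x)"
  shows "partial i f x = f' (axis i 1)"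
  unfolding partial_def using frechet_derivative_at[OF assms] by simp

text \<open>\<open>frechet_derivative\<close> is a choice from the set of derivatives at a point.
  Functions that agree near the point have the same such set, so the choices agree even if that set
  is empty.\<close>

lemma partial_cong_open:
  assumes "open U" "x \<in> U" "\<And>y. y \<in> U \<Longrightarrow> f y = g y"
  shows "partial i f x = partial i g x"
proof -
  have "(f has_derivative D) (at x) \<longleftrightarrow> (g has_derivative D) (at x)" for D
    using has_derivative_transform_within_open[of f D x UNIV U g]
      has_derivative_transform_within_open[of g D x UNIV U f] assms by auto
  then show ?thesis
    by (simp add: partial_def frechet_derivative_def)
qed

lemma partial_eq_0_open:
  assumes "open U" "x \<in> U" "\<And>y. y \<in> U \<Longrightarrow> f y = 0"
  shows "partial i f x = 0"
proof -
  have "partial i f x = partial i (\<lambda>_. 0) x"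
    by (rule partial_cong_open[OF assms(1,2)]) (simp add: assms(3))
  also have "\<dots> = 0"
    by (rule partial_eqI[OF has_derivative_const])
  finally show ?thesis .
qed

lemma partial_mult:
  fixes f g :: "real^'n::finite \<Rightarrow> real"
  assumes "f differentiable (at x)" "g differentiable (at x)"
  shows "partial i (\<lambda>y. f y * g y) x = partial i f x * g x + f x * partial i g x"
  using partial_eqI[OF has_derivative_mult[OF assms(1)[unfolded frechet_derivative_works]
      assms(2)[unfolded frechet_derivative_works]], of i]
  by (simp add: partial_def)

lemma partial_comp:
  fixes f :: "real^'n::finite \<Rightarrow> real"
  assumes "f differentiable (at x)" "(p has_real_derivative p') (at (f x))"
  shows "partial i (\<lambda>y. p (f y)) x = p' * partial i f x"
  using partial_eqI[OF has_derivative_compose[OF assms(1)[unfolded frechet_derivative_works]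
      assms(2)[unfolded has_field_derivative_def]], of i]
  by (simp add: partial_def)

text \<open>Restriction to a coordinate line makes the one-dimensional mean value inequality and
  difference quotients available for \<open>partial\<close>.\<close>

lemma has_derivative_along_axis:
  fixes F :: "real^'n::finite \<Rightarrow> real"
  assumes "F differentiable (at (x + s *\<^sub>R axis i 1))"
  shows "((\<lambda>s. F (x + s *\<^sub>R axis i 1)) has_real_derivative partial i F (x + s *\<^sub>R axis i 1)) (at s)"
proof -
  let ?D = "frechet_derivative F (at (x + s *\<^sub>R axis i 1))"
  have "((\<lambda>s. x + s *\<^sub>R axis i 1) has_derivative (\<lambda>r. r *\<^sub>R axis i 1)) (at s)"
    by (auto intro!: derivative_eq_intros)
  from has_derivative_compose[OF this assms[unfolded frechet_derivative_works]]
  have "((\<lambda>s. F (x + s *\<^sub>R axis i 1)) has_derivative (\<lambda>r. ?D (r *\<^sub>R axis i 1))) (at s)" .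
  moreover have "(\<lambda>r. ?D (r *\<^sub>R axis i 1)) = (*) (partial i F (x + s *\<^sub>R axis i 1))"
    using linear_frechet_derivative[OF assms] by (auto simp: partial_def linear_cmul mult.commute)
  ultimately show ?thesis
    by (simp add: has_field_derivative_def)
qed

lemma C1_onD:
  assumes "C_k_on 1 U f" "open U" "x \<in> U"
  shows "f differentiable (at x)"
  using assms by (auto simp: differentiable_on_eq_differentiable_at)

lemma C1_on_iff:
  assumes "open U"
  shows "C_k_on 1 U f \<longleftrightarrow> (\<forall>x\<in>U. f differentiable (at x)) \<and> (\<forall>i. continuous_on U (partial i f))"
  using assms by (auto simp: differentiable_on_eq_differentiable_at)

lemma C1_on_continuous: "C_k_on 1 U f \<Longrightarrow> continuous_on U f"
  by (auto simp: differentiable_imp_continuous_on)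

lemma C1_on_continuous_partial: "C_k_on 1 U f \<Longrightarrow> continuous_on U (partial i f)"
  by auto

lemma C1_on_subset:
  assumes "C_k_on 1 U f" "V \<subseteq> U" shows "C_k_on 1 V f"
  using assms by (auto intro: differentiable_on_subset continuous_on_subset)

lemma C1_on_mult:
  assumes U: "open U" and f: "C_k_on 1 U f" and g: "C_k_on 1 U g"
  shows "C_k_on 1 U (\<lambda>x. f x * g x)"
proof -
  have "continuous_on U (partial i (\<lambda>x. f x * g x))" for i
  proof (rule continuous_on_eq)
    show "continuous_on U (\<lambda>x. partial i f x * g x + f x * partial i g x)"
      by (intro continuous_intros C1_on_continuous C1_on_continuous_partial f g)
  qed (simp add: partial_mult[OF C1_onD[OF f U] C1_onD[OF g U]])
  moreover have "(\<lambda>x. f x * g x) differentiable (at x)" if "x \<in> U" for x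
    using C1_onD[OF f U that] C1_onD[OF g U that] by simp
  ultimately show ?thesis
    unfolding C1_on_iff[OF U] by blast
qed

lemma C1_on_comp:
  assumes U: "open U" and f: "C_k_on 1 U f"
    and p: "\<And>s. (p has_real_derivative p' s) (at s)" and p': "continuous_on UNIV p'"
  shows "C_k_on 1 U (\<lambda>x. p (f x))"
proof -
  have "continuous_on U (partial i (\<lambda>x. p (f x)))" for i
  proof (rule continuous_on_eq)
    show "continuous_on U (\<lambda>x. p' (f x) * partial i f x)"
      by (intro continuous_intros continuous_on_compose2[OF p'] C1_on_continuous
          C1_on_continuous_partial f) auto
  qed (use partial_comp[OF C1_onD[OF f U] p] in auto)
  moreover have "(\<lambda>x. p (f x)) differentiable (at x)" if "x \<in> U" for x
    using C1_onD[OF f U that] p[of "f x"]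
    by (auto simp: differentiable_def has_field_derivative_def intro: has_derivative_compose)
  ultimately show ?thesis
    unfolding C1_on_iff[OF U] by blast
qed

text \<open>The open sets \<open>U\<close> and \<open>- K\<close> cover the space, and the extension
  is continuous on each: it is f on the first and constantly 0 on the second.\<close>

lemma continuous_on_extend_zero:
  fixes f :: "'a::t2_space \<Rightarrow> 'b::{topological_space,zero}"
  assumes U: "open U" and K: "compact K" and f: "continuous_on U f"
    and z: "\<And>x. x \<in> U - K \<Longrightarrow> f x = 0" and "K \<subseteq> U"
  shows "continuous_on UNIV (\<lambda>x. if x \<in> U then f x else 0)"
proof -
  let ?F = "\<lambda>x. if x \<in> U then f x else 0"
  have "continuous_on (U \<union> - K) ?F"
  proof (rule continuous_on_open_Un)
    show "continuous_on U ?F" using f by (rule continuous_on_eq) auto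
    show "continuous_on (-K) ?F"
      by (rule continuous_on_eq[OF continuous_on_const[of _ 0]]) (use z in auto)
  qed (use U K in \<open>auto simp: compact_imp_closed open_Compl\<close>)
  moreover have "U \<union> - K = UNIV" using \<open>K \<subseteq> U\<close> by auto
  ultimately show ?thesis by simp
qed

section \<open>Integration by parts\<close>

text \<open>By translation invariance all difference quotients of \<open>F\<close> have integral \<open>0\<close>.\<close>

lemma integral_partial_eq_0:
  fixes F :: "real^'n::finite \<Rightarrow> real"
  assumes F: "C_k_on 1 UNIV F" and K: "compact K" and z: "\<And>x. x \<notin> K \<Longrightarrow> F x = 0"
  shows "integral\<^sup>L lborel (partial i F) = 0"
proof -
  define e :: "real^'n" where "e = axis i 1"
  \<comment> \<open>Step sizes that are positive, at most 1 and tend to 0.\<close>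
  define q where "q k = 1 / (real k + 1)" for k :: nat
  define D where "D k x = (F (x + q k *\<^sub>R e) - F x) / q k" for k x
  \<comment> \<open>All steps have length at most 1, so every difference quotient vanishes outside
    this one compact neighbourhood of K; a constant times its indicator dominates them all.\<close>
  define K' where "K' = {x + y |x y. x \<in> K \<and> y \<in> cball 0 1}"
  have K': "compact K'"
    unfolding K'_def by (rule compact_sums) (use K in auto)
  have q: "0 < q k" "q k \<le> 1" for k
    by (auto simp: q_def)
  have qn: "q k \<noteq> 0" for k
    using q(1)[of k] by linarith
  have diff: "F differentiable (at x)" for x
    using C1_onD[OF F] by auto
  have cont: "continuous_on UNIV (partial i F)"
    by (rule C1_on_continuous_partial[OF F])
  have contF: "continuous_on UNIV F"
    by (rule C1_on_continuous[OF F])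
  have z': "partial i F x = 0" if "x \<notin> K" for x
    by (rule partial_eq_0_open[of "-K"]) (use that z K in \<open>auto simp: compact_imp_closed open_Compl\<close>)
  have "bounded (partial i F ` K)"
    by (intro compact_imp_bounded compact_continuous_image continuous_on_subset[OF cont] K) auto
  then obtain B where B0: "0 < B" and B1: "\<And>x. x \<in> K \<Longrightarrow> norm (partial i F x) \<le> B"
    unfolding bounded_pos by auto
  then have B: "norm (partial i F x) \<le> B" for x
    using z'[of x] by (cases "x \<in> K") auto
  have bound: "norm (D k x) \<le> indicator K' x * B" for k x
  proof (cases "x \<in> K'")
    case True
    have "norm (F (x + q k *\<^sub>R e) - F (x + 0 *\<^sub>R e)) \<le> B * norm (q k - 0)"
      unfolding e_def
      by (rule field_differentiable_bound[of UNIV "\<lambda>s. F (x + s *\<^sub>R axis i 1)"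
            "\<lambda>s. partial i F (x + s *\<^sub>R axis i 1)"])
        (auto intro: has_derivative_along_axis diff B[unfolded real_norm_def])
    then show ?thesis using True q[of k] by (simp add: D_def divide_le_eq)
  next
    case False
    have "x \<notin> K"
    proof
      assume "x \<in> K"
      then have "x + 0 \<in> K'" unfolding K'_def by (intro CollectI exI conjI) auto
      with False show False by simp
    qed
    moreover have "x + q k *\<^sub>R e \<notin> K"
    proof
      assume "x + q k *\<^sub>R e \<in> K"
      then have "(x + q k *\<^sub>R e) + - q k *\<^sub>R e \<in> K'"
        unfolding K'_def using q[of k]
        by (intro CollectI exI[of _ "x + q k *\<^sub>R e"] exI[of _ "- q k *\<^sub>R e"])
          (auto simp: e_def norm_axis_1)
      with False show False by simp
    qed
    ultimately show ?thesis using False by (simp add: D_def z)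
  qed
  have meas: "F \<in> borel_measurable borel" "partial i F \<in> borel_measurable borel"
    using contF cont by (auto intro: borel_measurable_continuous_onI)
  have intF: "integrable lborel F"
  proof -
    have "integrable lborel (\<lambda>x. indicator K x *\<^sub>R F x)"
      by (rule borel_integrable_compact[OF K]) (rule continuous_on_subset[OF contF], simp)
    also have "(\<lambda>x. indicator K x *\<^sub>R F x) = F"
      using z by (intro ext) (auto simp: indicator_def)
    finally show ?thesis .
  qed
  have shift: "integrable lborel (\<lambda>x. F (x + y))" "(LINT x|lborel. F (x + y)) = integral\<^sup>L lborel F" for y
  proof -
    have "integral\<^sup>L lborel F = integral\<^sup>L (distr lborel borel ((+) y)) F"
      by (simp add: lborel_distr_plus)
    also have "\<dots> = (LINT x|lborel. F (y + x))"
      by (rule integral_distr) (use meas in auto)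
    finally show "(LINT x|lborel. F (x + y)) = integral\<^sup>L lborel F" by (simp add: add.commute)
    have "integrable (distr lborel borel ((+) y)) F"
      using intF by (simp add: lborel_distr_plus)
    then have "integrable lborel (\<lambda>x. F (y + x))"
      by (subst (asm) integrable_distr_eq) (use meas in auto)
    then show "integrable lborel (\<lambda>x. F (x + y))" by (simp add: add.commute)
  qed
  have D0: "integral\<^sup>L lborel (D k) = 0" for k
  proof -
    have "integral\<^sup>L lborel (D k) = (integral\<^sup>L lborel F - integral\<^sup>L lborel F) / q k"
      unfolding D_def by (simp add: shift intF)
    then show ?thesis by simp
  qed
  have "(\<lambda>k. integral\<^sup>L lborel (D k)) \<longlonglongrightarrow> integral\<^sup>L lborel (partial i F)"
  proof (rule integral_dominated_convergence)
    show "partial i F \<in> borel_measurable lborel" using meas by simp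
    show "D k \<in> borel_measurable lborel" for k
      unfolding D_def using shift(1) intF by (auto intro!: borel_measurable_divide borel_measurable_diff
          borel_measurable_integrable)
    show "integrable lborel (\<lambda>x. indicator K' x * B)"
      using borel_integrable_compact[OF K', of "\<lambda>_. B"] by simp
    show "AE x in lborel. (\<lambda>k. D k x) \<longlonglongrightarrow> partial i F x"
    proof (rule AE_I2)
      fix x
      have "((\<lambda>s. F (x + s *\<^sub>R e)) has_real_derivative partial i F (x + 0 *\<^sub>R e)) (at 0)"
        unfolding e_def by (rule has_derivative_along_axis) (simp add: diff)
      then have L: "((\<lambda>s. (F (x + s *\<^sub>R e) - F x) / s) \<longlongrightarrow> partial i F x) (at 0)"
        by (simp add: has_field_derivative_iff)
      have q0: "q \<longlonglongrightarrow> 0"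
        unfolding q_def using LIMSEQ_inverse_real_of_nat by (simp add: inverse_eq_divide add.commute)
      have "(\<lambda>k. (F (x + q k *\<^sub>R e) - F x) / q k) \<longlonglongrightarrow> partial i F x"
        using L[unfolded tendsto_at_iff_sequentially, rule_format, of q] q0 qn
        by (simp add: comp_def)
      then show "(\<lambda>k. D k x) \<longlonglongrightarrow> partial i F x" by (simp add: D_def)
    qed
    show "AE x in lborel. norm (D k x) \<le> indicator K' x * B" for k
      using bound by auto
  qed
  then show ?thesis by (simp add: D0 LIMSEQ_const_iff)
qed

text \<open>Vanishing is demanded only on \<open>U - K\<close>: a truncation of \<open>h t\<close>
  keeps whatever values come from \<open>h t\<close> outside the domain. Extension by zero is
  therefore carried out explicitly where it is needed.\<close>

definition C1c :: "(real^'n::finite) set \<Rightarrow> (real^'n \<Rightarrow> real) \<Rightarrow> bool" where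
  "C1c U g \<longleftrightarrow> C_k_on 1 U g \<and> (\<exists>K. compact K \<and> K \<subseteq> U \<and> (\<forall>x\<in>U - K. g x = 0))"

text \<open>Passes from \<open>lebesgue_on U\<close>, in which the scalar products are written, to
  \<open>lborel\<close>, where translation invariance is used. The zero extension is continuous,
  hence Borel, so the completion does not change its integral.\<close>

lemma integral_lebesgue_on_extend:
  fixes f :: "real^'n::finite \<Rightarrow> real"
  assumes U: "open U" and K: "compact K" "K \<subseteq> U" and f: "continuous_on U f"
    and z: "\<And>x. x \<in> U - K \<Longrightarrow> f x = 0"
  shows "integral\<^sup>L (lebesgue_on U) f = (LINT x|lborel. (if x \<in> U then f x else 0))"
    and "integrable (lebesgue_on U) f"
proof -
  let ?F = "\<lambda>x. if x \<in> U then f x else 0"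
  have eq: "(\<lambda>x. indicator U x * f x) = ?F" by (auto simp: indicator_def)
  have c: "continuous_on UNIV ?F" by (rule continuous_on_extend_zero[OF U K(1) f z K(2)])
  then have m: "?F \<in> borel_measurable lborel"
    by (simp add: borel_measurable_continuous_onI)
  show "integral\<^sup>L (lebesgue_on U) f = (LINT x|lborel. ?F x)"
    using U by (simp add: integral_restrict_space eq integral_completion[OF m])
  have "integrable lborel (\<lambda>x. indicator K x *\<^sub>R ?F x)"
    by (rule borel_integrable_compact[OF K(1)]) (rule continuous_on_subset[OF c], simp)
  also have "(\<lambda>x. indicator K x *\<^sub>R ?F x) = ?F"
    using z by (intro ext) (auto simp: indicator_def)
  finally show "integrable (lebesgue_on U) f"
    using U by (simp add: integrable_restrict_space eq integrable_completion[OF m])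
qed

lemma C1c_partial_zero:
  assumes "open U" "compact K" "\<And>x. x \<in> U - K \<Longrightarrow> g x = 0" "x \<in> U - K"
  shows "partial i g x = 0"
  using assms by (intro partial_eq_0_open[of "U - K"]) (auto simp: compact_imp_closed open_Diff)

text \<open>The product f g, extended by zero, is \<open>C\<^sup>1\<close> on the whole space, so
  the integral of its partial derivative is 0. The factor f may blow up at the boundary of U,
  because g vanishes there.\<close>

lemma integration_by_parts_C1c:
  fixes f g :: "real^'n::finite \<Rightarrow> real"
  assumes U: "open U" and f: "C_k_on 1 U f" and g: "C1c U g"
  shows "(LINT x|lebesgue_on U. f x * partial i g x) = - (LINT x|lebesgue_on U. partial i f x * g x)"
    and "integrable (lebesgue_on U) (\<lambda>x. f x * partial i g x)"
    and "integrable (lebesgue_on U) (\<lambda>x. partial i f x * g x)"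
proof -
  obtain K where K: "compact K" "K \<subseteq> U" and z: "\<And>x. x \<in> U - K \<Longrightarrow> g x = 0"
    and g1: "C_k_on 1 U g"
    using g unfolding C1c_def by blast
  have z': "partial i g x = 0" if "x \<in> U - K" for x i
    by (rule C1c_partial_zero[OF U K(1) z that])
  show i1: "integrable (lebesgue_on U) (\<lambda>x. f x * partial i g x)"
    by (rule integral_lebesgue_on_extend(2)[OF U K])
      (use z' in \<open>auto intro!: continuous_intros C1_on_continuous[OF f] C1_on_continuous_partial[OF g1]\<close>)
  show i2: "integrable (lebesgue_on U) (\<lambda>x. partial i f x * g x)"
    by (rule integral_lebesgue_on_extend(2)[OF U K])
      (use z in \<open>auto intro!: continuous_intros C1_on_continuous[OF g1] C1_on_continuous_partial[OF f]\<close>)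
  define F where "F x = (if x \<in> U then f x * g x else 0)" for x
  define S where "S i x = partial i f x * g x + f x * partial i g x" for i x
  have fg: "C_k_on 1 U (\<lambda>x. f x * g x)" by (rule C1_on_mult[OF U f g1])
  have pF: "partial i F x = (if x \<in> U then S i x else 0)" for i x
  proof (cases "x \<in> U")
    case True
    have "partial i F x = partial i (\<lambda>x. f x * g x) x"
      by (rule partial_cong_open[OF U True]) (simp add: F_def)
    then show ?thesis
      using True partial_mult[OF C1_onD[OF f U True] C1_onD[OF g1 U True]] by (simp add: S_def)
  next
    case False
    have "partial i F x = 0"
      \<comment> \<open>A point outside U lies in the open set \<open>- K\<close>, on which F is 0
        throughout; this is what covers the frontier of U.\<close>
      by (rule partial_eq_0_open[of "-K"])
        (use z K False in \<open>auto simp: F_def compact_imp_closed open_Compl\<close>)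
    then show ?thesis using False by simp
  qed
  have contS: "continuous_on U (S i)" for i
    unfolding S_def by (intro continuous_intros C1_on_continuous C1_on_continuous_partial f g1)
  have zS: "S i x = 0" if "x \<in> U - K" for i x
    using z z' that by (simp add: S_def)
  have "continuous_on UNIV (partial i F)" for i
    unfolding pF by (rule continuous_on_extend_zero[OF U K(1) contS zS K(2)])
  moreover have "F differentiable (at x)" for x
  proof (cases "x \<in> U")
    case True
    have "((\<lambda>x. f x * g x) has_derivative frechet_derivative (\<lambda>x. f x * g x) (at x)) (at x)"
      using C1_onD[OF fg U True] by (simp add: frechet_derivative_works)
    then have "(F has_derivative frechet_derivative (\<lambda>x. f x * g x) (at x)) (at x)"
      by (rule has_derivative_transform_within_open[OF _ U True]) (simp add: F_def)
    then show ?thesis by (auto simp: differentiable_def)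
  next
    case False
    have "(F has_derivative (\<lambda>_. 0)) (at x)"
      by (rule has_derivative_transform_within_open[of "\<lambda>_. 0" _ _ _ "-K"])
        (use z K False in \<open>auto simp: F_def compact_imp_closed open_Compl\<close>)
    then show ?thesis by (auto simp: differentiable_def)
  qed
  ultimately have F1: "C_k_on 1 UNIV F" by (simp only: C1_on_iff[OF open_UNIV] simp_thms ball_UNIV)
  have "integral\<^sup>L lborel (partial i F) = 0"
    by (rule integral_partial_eq_0[OF F1 K(1)]) (use z in \<open>auto simp: F_def\<close>)
  moreover have "integral\<^sup>L (lebesgue_on U) (S i) = integral\<^sup>L lborel (partial i F)"
    unfolding pF[abs_def] by (rule integral_lebesgue_on_extend(1)[OF U K contS zS])
  ultimately have "integral\<^sup>L (lebesgue_on U) (S i) = 0" by simp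
  then show "(LINT x|lebesgue_on U. f x * partial i g x) = - (LINT x|lebesgue_on U. partial i f x * g x)"
    using i1 i2 by (simp add: S_def[abs_def])
qed

section \<open>Square-integrable functions\<close>

lemma L2_dominated:
  fixes f :: "real^'n::finite \<Rightarrow> 'b::euclidean_space" and G :: "real^'n \<Rightarrow> 'c::euclidean_space"
  assumes f: "f \<in> borel_measurable (lebesgue_on \<Omega>)" and G: "G \<in> L2 \<Omega>"
    and le: "\<And>x. x \<in> \<Omega> \<Longrightarrow> norm (f x) \<le> C * norm (G x)"
  shows "f \<in> L2 \<Omega>"
proof -
  have "integrable (lebesgue_on \<Omega>) (\<lambda>x. C\<^sup>2 * (norm (G x))\<^sup>2)"
    using G by (simp add: L2_def)
  then have "integrable (lebesgue_on \<Omega>) (\<lambda>x. (norm (f x))\<^sup>2)"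
  proof (rule Bochner_Integration.integrable_bound)
    have "(norm (f x))\<^sup>2 \<le> C\<^sup>2 * (norm (G x))\<^sup>2" if "x \<in> \<Omega>" for x
      using power_mono[OF le[OF that], of 2] by (simp add: power_mult_distrib)
    then show "AE x in lebesgue_on \<Omega>. norm ((norm (f x))\<^sup>2) \<le> norm (C\<^sup>2 * (norm (G x))\<^sup>2)"
      by (intro AE_I2) auto
  qed (use f in measurable)
  with f show ?thesis by (simp add: L2_def)
qed

lemma L2_add:
  fixes f g :: "real^'n::finite \<Rightarrow> 'b::euclidean_space"
  assumes f: "f \<in> L2 \<Omega>" and g: "g \<in> L2 \<Omega>"
  shows "(\<lambda>x. f x + g x) \<in> L2 \<Omega>"
proof -
  have [measurable]: "f \<in> borel_measurable (lebesgue_on \<Omega>)" "g \<in> borel_measurable (lebesgue_on \<Omega>)"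
    using f g by (auto simp: L2_def)
  have "integrable (lebesgue_on \<Omega>) (\<lambda>x. 2 * (norm (f x))\<^sup>2 + 2 * (norm (g x))\<^sup>2)"
    using f g by (simp add: L2_def)
  then have "integrable (lebesgue_on \<Omega>) (\<lambda>x. (norm (f x + g x))\<^sup>2)"
  proof (rule Bochner_Integration.integrable_bound)
    have "(norm (f x + g x))\<^sup>2 \<le> 2 * (norm (f x))\<^sup>2 + 2 * (norm (g x))\<^sup>2" for x
      using power_mono[OF norm_triangle_ineq[of "f x" "g x"], of 2]
        sum_squares_bound[of "norm (f x)" "norm (g x)"] by (simp add: power2_sum)
    then show "AE x in lebesgue_on \<Omega>. norm ((norm (f x + g x))\<^sup>2)
        \<le> norm (2 * (norm (f x))\<^sup>2 + 2 * (norm (g x))\<^sup>2)"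
      by (intro AE_I2) auto
  qed measurable
  then show ?thesis by (simp add: L2_def)
qed

lemma L2_bounded_scaleR:
  fixes f :: "real^'n::finite \<Rightarrow> 'b::euclidean_space"
  assumes f: "f \<in> L2 \<Omega>" and m: "m \<in> borel_measurable (lebesgue_on \<Omega>)"
    and le: "\<And>x. x \<in> \<Omega> \<Longrightarrow> \<bar>m x\<bar> \<le> C"
  shows "(\<lambda>x. m x *\<^sub>R f x) \<in> L2 \<Omega>"
proof (rule L2_dominated[where C = C, OF _ f])
  show "(\<lambda>x. m x *\<^sub>R f x) \<in> borel_measurable (lebesgue_on \<Omega>)"
    using f m by (auto simp: L2_def)
qed (simp add: le mult_right_mono)

lemma L2_scaleR:
  fixes f :: "real^'n::finite \<Rightarrow> 'b::euclidean_space"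
  assumes "f \<in> L2 \<Omega>" shows "(\<lambda>x. c *\<^sub>R f x) \<in> L2 \<Omega>"
  by (rule L2_bounded_scaleR[OF assms, of _ "\<bar>c\<bar>"]) auto

lemma L2_diff:
  fixes f g :: "real^'n::finite \<Rightarrow> 'b::euclidean_space"
  assumes f: "f \<in> L2 \<Omega>" and g: "g \<in> L2 \<Omega>"
  shows "(\<lambda>x. f x - g x) \<in> L2 \<Omega>"
  using L2_add[OF f L2_scaleR[OF g, of "-1"]] by simp

lemma integrable_L2_inner:
  fixes f g :: "real^'n::finite \<Rightarrow> 'b::euclidean_space"
  assumes f: "f \<in> L2 \<Omega>" and g: "g \<in> L2 \<Omega>"
  shows "integrable (lebesgue_on \<Omega>) (\<lambda>x. f x \<bullet> g x)"
proof -
  have [measurable]: "f \<in> borel_measurable (lebesgue_on \<Omega>)" "g \<in> borel_measurable (lebesgue_on \<Omega>)"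
    using f g by (auto simp: L2_def)
  have "integrable (lebesgue_on \<Omega>) (\<lambda>x. (norm (f x))\<^sup>2 + (norm (g x))\<^sup>2)"
    using f g by (simp add: L2_def)
  then show ?thesis
  proof (rule Bochner_Integration.integrable_bound)
    have "\<bar>f x \<bullet> g x\<bar> \<le> (norm (f x))\<^sup>2 + (norm (g x))\<^sup>2" for x
      using Cauchy_Schwarz_ineq2[of "f x" "g x"] sum_squares_bound[of "norm (f x)" "norm (g x)"]
        mult_nonneg_nonneg[OF norm_ge_zero[of "f x"] norm_ge_zero[of "g x"]] by linarith
    then show "AE x in lebesgue_on \<Omega>. norm (f x \<bullet> g x) \<le> norm ((norm (f x))\<^sup>2 + (norm (g x))\<^sup>2)"
      by (intro AE_I2) auto
  qed measurable
qed

lemma L2_inner_self: "L2_inner \<Omega> f f = (LINT x|lebesgue_on \<Omega>. (norm (f x))\<^sup>2)"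
  by (simp add: L2_inner_def power2_norm_eq_inner)

lemma L2_inner_self_nonneg: "0 \<le> L2_inner \<Omega> f f"
  by (simp add: L2_inner_self)

lemma L2_norm_square: "(L2_norm \<Omega> f)\<^sup>2 = L2_inner \<Omega> f f"
  by (simp add: L2_norm_def L2_inner_self_nonneg)

lemma L2_inner_diff_right:
  fixes f g w :: "real^'n::finite \<Rightarrow> 'b::euclidean_space"
  assumes "f \<in> L2 \<Omega>" "g \<in> L2 \<Omega>" "w \<in> L2 \<Omega>"
  shows "L2_inner \<Omega> f (\<lambda>x. g x - w x) = L2_inner \<Omega> f g - L2_inner \<Omega> f w"
  unfolding L2_inner_def using assms by (simp add: inner_diff_right integrable_L2_inner)

text \<open>The squared norm of f - t g is a nonnegative quadratic polynomial in t.\<close>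

lemma L2_Cauchy_Schwarz:
  fixes f g :: "real^'n::finite \<Rightarrow> 'b::euclidean_space"
  assumes f: "f \<in> L2 \<Omega>" and g: "g \<in> L2 \<Omega>"
  shows "\<bar>L2_inner \<Omega> f g\<bar> \<le> L2_norm \<Omega> f * L2_norm \<Omega> g"
proof -
  define A B C where "A = L2_inner \<Omega> f f" and "B = L2_inner \<Omega> g g" and "C = L2_inner \<Omega> f g"
  have quad: "0 \<le> A - 2 * t * C + t\<^sup>2 * B" for t
  proof -
    have "0 \<le> L2_inner \<Omega> (\<lambda>x. f x - t *\<^sub>R g x) (\<lambda>x. f x - t *\<^sub>R g x)"
      by (rule L2_inner_self_nonneg)
    also have "\<dots> = (LINT x|lebesgue_on \<Omega>. f x \<bullet> f x - 2 * t * (f x \<bullet> g x) + t\<^sup>2 * (g x \<bullet> g x))"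
      unfolding L2_inner_def
      by (rule Bochner_Integration.integral_cong)
        (auto simp: inner_diff_left inner_diff_right inner_commute power2_eq_square algebra_simps)
    also have "\<dots> = A - 2 * t * C + t\<^sup>2 * B"
      unfolding A_def B_def C_def L2_inner_def using f g by (simp add: integrable_L2_inner)
    finally show ?thesis .
  qed
  have AB: "0 \<le> A" "0 \<le> B" by (auto simp: A_def B_def L2_inner_self_nonneg)
  have "C\<^sup>2 \<le> A * B"
  proof (cases "B = 0")
    case True
    have "C = 0"
    proof (rule ccontr)
      assume "C \<noteq> 0"
      \<comment> \<open>For B = 0 the polynomial is affine, and this t gives it the value
        -1.\<close>
      then show False using quad[of "(A + 1) / (2 * C)"] True by simp
    qed
    then show ?thesis using True by simp
  next
    case False
    then have "0 \<le> A - C\<^sup>2 / B"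
      \<comment> \<open>The minimizer of the quadratic.\<close>
      using quad[of "C / B"] by (simp add: power2_eq_square)
    then show ?thesis using False AB by (simp add: field_simps)
  qed
  then have "sqrt (C\<^sup>2) \<le> sqrt (A * B)" by (rule real_sqrt_le_mono)
  then show ?thesis by (simp add: L2_norm_def A_def B_def C_def real_sqrt_mult)
qed

lemma L2_inner_tendsto:
  fixes f q :: "real^'n::finite \<Rightarrow> 'b::euclidean_space"
  assumes f: "f \<in> L2 \<Omega>" and q: "q \<in> L2 \<Omega>" and u: "\<And>k. u k \<in> L2 \<Omega>"
    and lim: "(\<lambda>k. L2_norm \<Omega> (\<lambda>x. u k x - q x)) \<longlonglongrightarrow> 0"
  shows "(\<lambda>k. L2_inner \<Omega> f (u k)) \<longlonglongrightarrow> L2_inner \<Omega> f q"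
proof (rule LIM_zero_cancel, rule Lim_null_comparison)
  show "\<forall>\<^sub>F k in sequentially. norm (L2_inner \<Omega> f (u k) - L2_inner \<Omega> f q)
      \<le> L2_norm \<Omega> f * L2_norm \<Omega> (\<lambda>x. u k x - q x)"
    using L2_Cauchy_Schwarz[OF f L2_diff[OF u q]]
    by (simp add: L2_inner_diff_right[OF f u q])
  show "(\<lambda>k. L2_norm \<Omega> f * L2_norm \<Omega> (\<lambda>x. u k x - q x)) \<longlonglongrightarrow> 0"
    using tendsto_mult_left[OF lim, of "L2_norm \<Omega> f"] by simp
qed

section \<open>Divergence theorem against functions in the \<open>H\<^sup>1\<close> closure of
  \<open>C1c\<close>\<close>

lemma continuous_on_grad: "C_k_on 1 U f \<Longrightarrow> continuous_on U (grad f)"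
  unfolding grad_def by (intro continuous_on_vec_lambda) auto

lemma measurable_lebesgue_on_open:
  fixes f :: "real^'n::finite \<Rightarrow> 'b::euclidean_space"
  assumes "open U" "continuous_on U f"
  shows "f \<in> borel_measurable (lebesgue_on U)"
  using assms by (intro continuous_imp_measurable_on_sets_lebesgue) auto

lemma C1c_L2:
  assumes U: "open U" and g: "C1c U g"
  shows "g \<in> L2 U" "grad g \<in> L2 U"
proof -
  obtain K where K: "compact K" "K \<subseteq> U" and z: "\<And>x. x \<in> U - K \<Longrightarrow> g x = 0"
    and g1: "C_k_on 1 U g"
    using g unfolding C1c_def by blast
  have z': "grad g x = 0" if "x \<in> U - K" for x
    using C1c_partial_zero[OF U K(1) z that] by (simp add: grad_def vec_eq_iff)
  have "integrable (lebesgue_on U) (\<lambda>x. (norm (g x))\<^sup>2)"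
    by (rule integral_lebesgue_on_extend(2)[OF U K])
      (use z in \<open>auto intro!: continuous_intros C1_on_continuous[OF g1]\<close>)
  then show "g \<in> L2 U"
    using measurable_lebesgue_on_open[OF U C1_on_continuous[OF g1]] by (simp add: L2_def)
  have "integrable (lebesgue_on U) (\<lambda>x. (norm (grad g x))\<^sup>2)"
    by (rule integral_lebesgue_on_extend(2)[OF U K])
      (use z' in \<open>auto intro!: continuous_intros continuous_on_grad[OF g1]\<close>)
  then show "grad g \<in> L2 U"
    using measurable_lebesgue_on_open[OF U continuous_on_grad[OF g1]] by (simp add: L2_def)
qed

text \<open>The closure of \<open>C1c\<close> in the \<open>H\<^sup>1\<close> norm.  Using \<open>C1c\<close> in place of test functions admits truncations
  of \<open>h\<close> as approximants without mollifying them.\<close>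

definition C1_approx :: "(real^'n::finite) set \<Rightarrow> (real^'n \<Rightarrow> real) \<Rightarrow> (real^'n \<Rightarrow> real^'n) \<Rightarrow> bool" where
  "C1_approx U q Dq \<longleftrightarrow> q \<in> L2 U \<and> Dq \<in> L2 U \<and>
     (\<exists>g. (\<forall>k::nat. C1c U (g k))
        \<and> (\<lambda>k. L2_norm U (\<lambda>x. g k x - q x)) \<longlonglongrightarrow> 0
        \<and> (\<lambda>k. L2_norm U (\<lambda>x. grad (g k) x - Dq x)) \<longlonglongrightarrow> 0)"

lemma divergence_theorem_C1c:
  fixes u :: "real^'n::finite \<Rightarrow> real^'n"
  assumes U: "open U" and u: "\<And>i. C_k_on 1 U (\<lambda>x. u x $ i)" and g: "C1c U g"
  shows "L2_inner U (divergence u) g = - L2_inner U u (grad g)"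
proof -
  note ibp = integration_by_parts_C1c[OF U u g]
  have "L2_inner U (divergence u) g
      = (\<Sum>i\<in>UNIV. LINT x|lebesgue_on U. partial i (\<lambda>y. u y $ i) x * g x)"
    unfolding L2_inner_def divergence_def
    using ibp(3) by (simp add: sum_distrib_right)
  also have "\<dots> = - (\<Sum>i\<in>UNIV. LINT x|lebesgue_on U. u x $ i * partial i g x)"
    by (simp add: ibp(1) sum_negf)
  also have "\<dots> = - L2_inner U u (grad g)"
    unfolding L2_inner_def grad_def using ibp(2) by (simp add: inner_vec_def)
  finally show ?thesis .
qed

text \<open>Both sides are continuous in the \<open>H\<^sup>1\<close> norm of the test function.
  Square-integrability is required of u and of its divergence as a whole, not of the
  summands.\<close>

lemma divergence_theorem_C1_approx:
  fixes u :: "real^'n::finite \<Rightarrow> real^'n"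
  assumes U: "open U" and u: "\<And>i. C_k_on 1 U (\<lambda>x. u x $ i)"
    and L2: "u \<in> L2 U" "divergence u \<in> L2 U" and q: "C1_approx U q Dq"
  shows "L2_inner U (divergence u) q = - L2_inner U u Dq"
proof -
  obtain g where g: "\<And>k::nat. C1c U (g k)"
    and lim: "(\<lambda>k. L2_norm U (\<lambda>x. g k x - q x)) \<longlonglongrightarrow> 0"
      "(\<lambda>k. L2_norm U (\<lambda>x. grad (g k) x - Dq x)) \<longlonglongrightarrow> 0"
    and q: "q \<in> L2 U" "Dq \<in> L2 U"
    using q unfolding C1_approx_def by blast
  have "(\<lambda>k. L2_inner U (divergence u) (g k)) \<longlonglongrightarrow> L2_inner U (divergence u) q"
    by (rule L2_inner_tendsto[OF L2(2) q(1) C1c_L2(1)[OF U g] lim(1)])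
  moreover have "(\<lambda>k. - L2_inner U u (grad (g k))) \<longlonglongrightarrow> - L2_inner U u Dq"
    by (intro tendsto_minus L2_inner_tendsto[OF L2(1) q(2) C1c_L2(2)[OF U g] lim(2)])
  ultimately show ?thesis
    unfolding divergence_theorem_C1c[OF U u g] by (rule LIMSEQ_unique)
qed

lemma H10_imp_C1_approx:
  assumes "H10 \<Omega> q Dq"
  shows "C1_approx \<Omega> q Dq"
proof -
  obtain \<phi> where \<phi>: "\<And>k::nat. \<phi> k \<in> test_functions \<Omega>"
    and lim: "(\<lambda>k. sqrt ((L2_norm \<Omega> (\<lambda>x. \<phi> k x - q x))\<^sup>2
                        + (L2_norm \<Omega> (\<lambda>x. grad (\<phi> k) x - Dq x))\<^sup>2)) \<longlonglongrightarrow> 0"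
    and q: "q \<in> L2 \<Omega>" "Dq \<in> L2 \<Omega>"
    using assms unfolding H10_def H1_def by blast
  have "C1c \<Omega> (\<phi> k)" for k
  proof -
    have *: "C_k_on 1 UNIV (\<phi> k)" "compact (closure {x. \<phi> k x \<noteq> 0})" "closure {x. \<phi> k x \<noteq> 0} \<subseteq> \<Omega>"
      using \<phi>[of k] unfolding test_functions_def by blast+
    have "\<phi> k x = 0" if "x \<notin> closure {x. \<phi> k x \<noteq> 0}" for x
      using that closure_subset[of "{x. \<phi> k x \<noteq> 0}"] by blast
    with * C1_on_subset[OF *(1) subset_UNIV, of \<Omega>] show ?thesis unfolding C1c_def by blast
  qed
  moreover have "(\<lambda>k. L2_norm \<Omega> (\<lambda>x. \<phi> k x - q x)) \<longlonglongrightarrow> 0"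
    by (rule Lim_null_comparison[OF _ lim], rule always_eventually)
      (simp add: L2_norm_def L2_inner_self_nonneg)
  moreover have "(\<lambda>k. L2_norm \<Omega> (\<lambda>x. grad (\<phi> k) x - Dq x)) \<longlonglongrightarrow> 0"
    by (rule Lim_null_comparison[OF _ lim], rule always_eventually)
      (simp add: L2_norm_def L2_inner_self_nonneg)
  ultimately show ?thesis using q unfolding C1_approx_def by blast
qed

lemma divergence_grad: "divergence (grad f) x = laplacian f x"
  by (simp add: divergence_def laplacian_def grad_def)

lemma divergence_scaleR:
  fixes v :: "real^'n::finite \<Rightarrow> real^'n"
  assumes "h differentiable (at x)" "\<And>i. (\<lambda>y. v y $ i) differentiable (at x)"
  shows "divergence (\<lambda>y. h y *\<^sub>R v y) x = h x * divergence v x + v x \<bullet> grad h x"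
  by (simp add: divergence_def grad_def inner_vec_def partial_mult[OF assms] sum.distrib
      sum_distrib_left mult.commute)

lemma C2_on_partial: "C_k_on 2 U f \<Longrightarrow> C_k_on 1 U (partial i f)"
  by (simp add: numeral_2_eq_2)

lemma C2_on_imp_C1_on: "C_k_on 2 U f \<Longrightarrow> C_k_on 1 U f"
  by (auto simp: numeral_2_eq_2 intro: differentiable_imp_continuous_on)

section \<open>Approximation of functions vanishing on the boundary\<close>

text \<open>Squaring smooths the corner of the positive part: at 0 the difference quotient is at
  most \<open>\<bar>h\<bar>\<close>. Both the cutoff and \<open>trunc\<close> are built from this
  function.\<close>

lemma has_real_derivative_max_square:
  "((\<lambda>s. (max 0 s)\<^sup>2) has_real_derivative 2 * max 0 s) (at (s::real))"
proof -
  consider "s < 0" | "s = 0" | "s > 0" by linarith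
  then show ?thesis
  proof cases
    case 1
    have "((\<lambda>s. 0) has_real_derivative 0) (at s)" by simp
    then have "((\<lambda>s. (max 0 s)\<^sup>2) has_real_derivative 0) (at s)"
      by (rule has_field_derivative_transform_within_open[of _ _ _ "{..<0}"]) (use 1 in auto)
    then show ?thesis using 1 by simp
  next
    case 2
    have "((\<lambda>h. (max 0 h)\<^sup>2 / h) \<longlongrightarrow> 0) (at (0::real))"
    proof (rule Lim_null_comparison)
      show "\<forall>\<^sub>F h in at (0::real). norm ((max 0 h)\<^sup>2 / h) \<le> \<bar>h\<bar>"
        by (rule always_eventually) (auto simp: max_def power2_eq_square)
      show "((\<lambda>h. \<bar>h\<bar>) \<longlongrightarrow> 0) (at (0::real))"
        by (rule tendsto_rabs_zero) (rule tendsto_ident_at)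
    qed
    then show ?thesis using 2 by (simp add: has_field_derivative_iff)
  next
    case 3
    have "((\<lambda>s. s\<^sup>2) has_real_derivative 2 * s) (at s)" by (auto intro!: derivative_eq_intros)
    then have "((\<lambda>s. (max 0 s)\<^sup>2) has_real_derivative 2 * s) (at s)"
      by (rule has_field_derivative_transform_within_open[of _ _ _ "{0<..}"]) (use 3 in auto)
    then show ?thesis using 3 by simp
  qed
qed

text \<open>A cutoff that is positive exactly on the open ball of radius
  \<open>\<bar>r\<bar>\<close>; the outer square makes it \<open>C\<^sup>1\<close> across the
  sphere, which is all that \<open>C1c\<close> asks for.\<close>

lemma C1_bump:
  fixes x0 :: "real^'n::finite"
  shows "C_k_on 1 UNIV (\<lambda>x. (max 0 (r\<^sup>2 - (x - x0) \<bullet> (x - x0)))\<^sup>2)"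
proof (rule C1_on_comp[OF open_UNIV _ has_real_derivative_max_square])
  have d: "((\<lambda>x. r\<^sup>2 - (x - x0) \<bullet> (x - x0)) has_derivative (\<lambda>y. - (2 * ((x - x0) \<bullet> y)))) (at x)" for x
    by (auto intro!: derivative_eq_intros simp: inner_commute)
  have p: "partial i (\<lambda>x. r\<^sup>2 - (x - x0) \<bullet> (x - x0)) x = - (2 * ((x - x0) \<bullet> axis i 1))" for i x
    by (rule partial_eqI[OF d])
  show "C_k_on 1 UNIV (\<lambda>x. r\<^sup>2 - (x - x0) \<bullet> (x - x0))"
    unfolding C1_on_iff[OF open_UNIV] p[abs_def]
    using d by (auto simp: differentiable_def intro!: continuous_intros exI)
qed (intro continuous_intros)

text \<open>The terms are the derivatives of arctan (k s) / k with respect to s, for k running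
  through the positive integers; at s = 0 they are all 1.\<close>

lemma tendsto_inverse_one_plus_square:
  assumes "s \<noteq> 0"
  shows "(\<lambda>k. inverse (1 + (s * real (Suc k))\<^sup>2)) \<longlonglongrightarrow> 0"
proof (rule tendsto_inverse_0_at_top)
  have "filterlim (\<lambda>k. s\<^sup>2 * real (Suc k)) at_top sequentially"
    by (rule filterlim_tendsto_pos_mult_at_top[OF tendsto_const])
      (use assms filterlim_compose[OF filterlim_real_sequentially filterlim_Suc] in simp_all)
  then show "filterlim (\<lambda>k. 1 + (s * real (Suc k))\<^sup>2) at_top sequentially"
  proof (rule filterlim_at_top_mono, intro always_eventually allI)
    fix k
    have "s\<^sup>2 * real (Suc k) \<le> s\<^sup>2 * (real (Suc k))\<^sup>2"
      by (intro mult_left_mono) (auto simp: power2_eq_square)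
    then show "s\<^sup>2 * real (Suc k) \<le> 1 + (s * real (Suc k))\<^sup>2"
      by (simp add: power_mult_distrib)
  qed
qed

text \<open>Integrating \<open>arctan (k f) / k\<close>, which tends to \<open>0\<close> uniformly while its gradient tends to
  \<open>\<nabla>f\<close> on the zero set of \<open>f\<close> and to \<open>0\<close> elsewhere, against the derivative of \<open>\<rho> \<partial>\<^sub>i f\<close> for a
  cutoff \<open>\<rho>\<close> gives \<open>\<integral> \<rho> (\<partial>\<^sub>i f)\<^sup>2 = 0\<close> over the zero set.\<close>

lemma negligible_zero_partial_neq_0:
  fixes f :: "real^'n::finite \<Rightarrow> real"
  assumes U: "open U" and f: "C_k_on 2 U f"
  shows "negligible {x \<in> U. f x = 0 \<and> partial i f x \<noteq> 0}" (is "negligible ?S")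
proof (subst locally_negligible_alt, intro ballI)
  fix x0 assume x0: "x0 \<in> ?S"
  then obtain r where r: "r > 0" "cball x0 r \<subseteq> U"
    using U open_contains_cball by blast
  note f1 = C2_on_imp_C1_on[OF f] and pf1 = C2_on_partial[OF f]
  define \<rho> where "\<rho> x = (max 0 (r\<^sup>2 - (x - x0) \<bullet> (x - x0)))\<^sup>2" for x
  have \<rho>1: "C_k_on 1 U \<rho>"
    using C1_on_subset[OF C1_bump subset_UNIV] by (simp only: \<rho>_def[abs_def])
  have \<rho>0: "\<rho> x = 0" if "x \<notin> cball x0 r" for x
  proof -
    have "r\<^sup>2 \<le> (norm (x - x0))\<^sup>2"
      using that r by (intro power_mono) (auto simp: dist_norm norm_minus_commute)
    then show ?thesis by (simp add: \<rho>_def power2_norm_eq_inner)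
  qed
  have \<rho>pos: "\<rho> x > 0" if "x \<in> ball x0 r" for x
  proof -
    have "(norm (x - x0))\<^sup>2 < r\<^sup>2"
      using that r by (intro power_strict_mono) (auto simp: dist_norm norm_minus_commute)
    then show ?thesis by (simp add: \<rho>_def power2_norm_eq_inner)
  qed
  \<comment> \<open>The derivative of \<open>partial i f\<close> enters here, which is why f has to
    be \<open>C\<^sup>2\<close>. Paired with another factor \<open>partial i f\<close>, g gives the
    nonnegative w.\<close>
  define g where "g x = partial i f x * \<rho> x" for x
  have g1: "C_k_on 1 U g"
    unfolding g_def by (rule C1_on_mult[OF U pf1 \<rho>1])
  have g: "C1c U g"
    unfolding C1c_def using g1 r \<rho>0 by (auto intro!: exI[of _ "cball x0 r"] simp: g_def simp del: C_k_on.simps)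
  define w where "w x = partial i f x * g x" for x
  have w0: "0 \<le> w x" for x by (simp add: w_def g_def \<rho>_def flip: mult.assoc)
  have int_w: "integrable (lebesgue_on U) w"
    unfolding w_def using integration_by_parts_C1c(3)[OF U f1 g] .
  \<comment> \<open>Integration by parts against the constant 1 is invoked only for the
    integrability of \<open>partial i g\<close>.\<close>
  have "C_k_on 1 U (\<lambda>x. 1)"
    unfolding C1_on_iff[OF U] by (simp add: partial_eqI[OF has_derivative_const, abs_def])
  from integration_by_parts_C1c(2)[OF U this g]
  have int_g: "integrable (lebesgue_on U) (partial i g)" by simp
  have int_ag: "integrable (lebesgue_on U) (\<lambda>x. \<bar>partial i g x\<bar>)"
    using int_g by (rule integrable_abs)
  define F where "F k x = arctan (f x * real (Suc k)) / real (Suc k)" for k x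
  define F' where "F' k x = inverse (1 + (f x * real (Suc k))\<^sup>2)" for k x
  have dF: "((\<lambda>s. arctan (s * real (Suc k)) / real (Suc k)) has_real_derivative
      inverse (1 + (s * real (Suc k))\<^sup>2)) (at s)" for k s
    by (rule derivative_eq_intros refl | simp)+
  have nz: "1 + (s::real)\<^sup>2 \<noteq> 0" for s
    using zero_le_power2[of s] by linarith
  have F1: "C_k_on 1 U (F k)" for k
    unfolding F_def by (rule C1_on_comp[OF U f1 dF]) (intro continuous_intros ballI nz)
  have pF: "partial i (F k) x = F' k x * partial i f x" if "x \<in> U" for k x
    using partial_comp[OF C1_onD[OF f1 U that] dF] by (simp add: F_def[abs_def] F'_def)
  note contf = C1_on_continuous[OF f1]
  have ibp: "(LINT x|lebesgue_on U. F k x * partial i g x) = - (LINT x|lebesgue_on U. F' k x * w x)" for k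
    unfolding integration_by_parts_C1c(1)[OF U F1 g]
    by (subst Bochner_Integration.integral_cong[OF refl, of _ "\<lambda>x. partial i (F k) x * g x" "\<lambda>x. F' k x * w x"])
      (auto simp: pF w_def)
  have lim1: "(\<lambda>k. LINT x|lebesgue_on U. F k x * partial i g x) \<longlonglongrightarrow> (LINT x|lebesgue_on U. 0)"
  proof (rule integral_dominated_convergence)
    show "integrable (lebesgue_on U) (\<lambda>x. 2 * \<bar>partial i g x\<bar>)" using int_ag by simp
    show "(\<lambda>x. F k x * partial i g x) \<in> borel_measurable (lebesgue_on U)" for k
      by (rule borel_measurable_integrable[OF integration_by_parts_C1c(2)[OF U F1 g]])
    have b: "\<bar>F k x\<bar> \<le> 2 / real (Suc k)" for k x
    proof -
      \<comment> \<open>The number 2 is a convenient upper bound for \<open>pi / 2\<close>.\<close>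
      have "\<bar>arctan (f x * real (Suc k))\<bar> \<le> 2"
        using arctan_bounded[of "f x * real (Suc k)"] pi_less_4 by linarith
      then show ?thesis unfolding F_def abs_divide by (simp add: divide_right_mono)
    qed
    have "2 / real (Suc k) \<le> 2" for k by (simp add: field_simps)
    with b have b2: "\<bar>F k x\<bar> \<le> 2" for k x by (rule order_trans)
    show "AE x in lebesgue_on U. norm (F k x * partial i g x) \<le> 2 * \<bar>partial i g x\<bar>" for k
      using b2 by (auto simp: abs_mult intro!: mult_right_mono)
    show "AE x in lebesgue_on U. (\<lambda>k. F k x * partial i g x) \<longlonglongrightarrow> 0"
    proof (rule AE_I2, rule tendsto_mult_left_zero)
      fix x
      have "(\<lambda>k. 2 / real (Suc k)) \<longlonglongrightarrow> 0"
        using tendsto_mult_right_zero[OF LIMSEQ_inverse_real_of_nat, of 2] by (simp add: divide_inverse)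
      then show "(\<lambda>k. F k x) \<longlonglongrightarrow> 0"
        by (rule Lim_null_comparison[rotated]) (use b in auto)
    qed
  qed simp
  \<comment> \<open>The pointwise limit of \<open>F' k x * w x\<close>: the factor
    \<open>F' k x\<close> is 1 on the zero set and tends to 0 elsewhere.\<close>
  define Z where "Z x = (if f x = 0 then w x else 0)" for x
  have limZ: "(\<lambda>k. F' k x * w x) \<longlonglongrightarrow> Z x" for x
    using tendsto_mult_left_zero[OF tendsto_inverse_one_plus_square[of "f x"], of "w x"]
    by (cases "f x = 0") (auto simp: F'_def Z_def)
  have measF': "(\<lambda>x. F' k x * w x) \<in> borel_measurable (lebesgue_on U)" for k
    unfolding F'_def using int_w measurable_lebesgue_on_open[OF U contf] by measurable
  have bF': "AE x in lebesgue_on U. norm (F' k x * w x) \<le> w x" for k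
  proof (rule AE_I2)
    fix x
    have "inverse (1 + (f x * real (Suc k))\<^sup>2) \<le> inverse 1"
      by (rule le_imp_inverse_le) auto
    then show "norm (F' k x * w x) \<le> w x"
      using w0[of x] by (simp add: F'_def abs_mult mult_left_le_one_le)
  qed
  have measZ: "Z \<in> borel_measurable (lebesgue_on U)"
    by (rule borel_measurable_LIMSEQ_real[OF limZ measF'])
  have lim2: "(\<lambda>k. LINT x|lebesgue_on U. F' k x * w x) \<longlonglongrightarrow> integral\<^sup>L (lebesgue_on U) Z"
    by (rule integral_dominated_convergence[OF measZ measF' int_w _ bF']) (simp add: limZ)
  have "integral\<^sup>L (lebesgue_on U) Z = 0"
    using LIMSEQ_unique[OF lim1[unfolded ibp] tendsto_minus[OF lim2]] by simp
  moreover have "integrable (lebesgue_on U) Z"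
    by (rule Bochner_Integration.integrable_bound[OF int_w measZ]) (auto simp: Z_def w0)
  ultimately have "AE x in lebesgue_on U. Z x = 0"
    by (subst (asm) integral_nonneg_eq_0_iff_AE) (auto simp: Z_def w0)
  then have "AE x in lebesgue. x \<in> U \<longrightarrow> Z x = 0"
    using U by (simp add: AE_restrict_space_iff)
  then obtain N where N: "N \<in> null_sets lebesgue" "{x \<in> space lebesgue. \<not> (x \<in> U \<longrightarrow> Z x = 0)} \<subseteq> N"
    unfolding eventually_ae_filter by blast
  have neg: "negligible {x. \<not> (x \<in> U \<longrightarrow> Z x = 0)}"
    using N(2) by (intro negligible_subset[OF N(1)[folded negligible_iff_null_sets]]) simp
  \<comment> \<open>On the open ball the cutoff is positive, so at a zero of f the equation Z = 0
    forces \<open>partial i f x = 0\<close>.\<close>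
  have "negligible (?S \<inter> ball x0 r)"
  proof (rule negligible_subset[OF neg], safe)
    fix x assume "x \<in> U" "f x = 0" "partial i f x \<noteq> 0" "x \<in> ball x0 r" "Z x = 0"
    then show False using \<rho>pos[of x] by (simp add: Z_def w_def g_def)
  qed
  then show "\<exists>V. openin (top_of_set ?S) V \<and> x0 \<in> V \<and> negligible V"
    using x0 r(1) by (intro exI[of _ "?S \<inter> ball x0 r"]) auto
qed

text \<open>\<open>trunc e\<close> vanishes on \<open>[-e, e]\<close>, is \<open>C\<^sup>1\<close> with derivative bounded by a constant, and tends to the
  identity as \<open>e\<close> tends to \<open>0\<close>.\<close>

definition trunc :: "real \<Rightarrow> real \<Rightarrow> real" where
  "trunc e s = sqrt (e\<^sup>2 + (max 0 (s - e))\<^sup>2) - sqrt (e\<^sup>2 + (max 0 (- s - e))\<^sup>2)"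

definition trunc' :: "real \<Rightarrow> real \<Rightarrow> real" where
  "trunc' e s = max 0 (s - e) / sqrt (e\<^sup>2 + (max 0 (s - e))\<^sup>2)
     + max 0 (- s - e) / sqrt (e\<^sup>2 + (max 0 (- s - e))\<^sup>2)"

lemma trunc_eq_0: "\<bar>s\<bar> \<le> e \<Longrightarrow> trunc e s = 0"
  by (auto simp: trunc_def max_def)

lemma sum_squares_pos: "0 < e \<Longrightarrow> 0 < e\<^sup>2 + (y::real)\<^sup>2"
  by (simp add: add_pos_nonneg)

text \<open>The summand \<open>e\<^sup>2\<close> keeps each root away from its singularity at 0. On
  \<open>[-e, e]\<close> both roots equal e and cancel.\<close>

lemma has_real_derivative_trunc:
  assumes "e > 0"
  shows "(trunc e has_real_derivative trunc' e s) (at s)"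
proof -
  have 1: "((\<lambda>s. sqrt (e\<^sup>2 + (max 0 (l s))\<^sup>2)) has_real_derivative
      l' * (max 0 (l s) / sqrt (e\<^sup>2 + (max 0 (l s))\<^sup>2))) (at s)"
    if l: "(l has_real_derivative l') (at s)" for l l'
  proof -
    have "((\<lambda>s. (max 0 (l s))\<^sup>2) has_real_derivative 2 * max 0 (l s) * l') (at s)"
      by (rule DERIV_chain2[where f = "\<lambda>s. (max 0 s)\<^sup>2", OF has_real_derivative_max_square l])
    then have "((\<lambda>s. e\<^sup>2 + (max 0 (l s))\<^sup>2) has_real_derivative 2 * max 0 (l s) * l') (at s)"
      using DERIV_add[OF DERIV_const[of "e\<^sup>2"]] by force
    from DERIV_chain2[OF DERIV_real_sqrt[OF sum_squares_pos[OF assms]] this]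
    show ?thesis by (simp add: field_simps)
  qed
  have "((\<lambda>s. s - e) has_real_derivative 1) (at s)" "((\<lambda>s. - s - e) has_real_derivative -1) (at s)"
    by (auto intro!: derivative_eq_intros)
  from DERIV_diff[OF this[THEN 1]] show ?thesis
    by (simp add: trunc_def[abs_def] trunc'_def)
qed

lemma continuous_on_trunc':
  assumes "e > 0" shows "continuous_on UNIV (trunc' e)"
proof -
  have "sqrt (e\<^sup>2 + y\<^sup>2) \<noteq> 0" for y
    using sum_squares_pos[OF assms, of y] by (simp only: real_sqrt_eq_0_iff)
  then show ?thesis unfolding trunc'_def by (intro continuous_intros) auto
qed

text \<open>Each of the two quotients is at most 1 in absolute value. What matters later is that the
  bound is independent of e, so that it can serve in dominated convergence.\<close>

lemma abs_trunc'_le: "\<bar>trunc' e s\<bar> \<le> 2"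
proof -
  have "\<bar>max 0 y / sqrt (e\<^sup>2 + (max 0 y)\<^sup>2)\<bar> \<le> 1" for y
  proof -
    have "max 0 y \<le> sqrt (e\<^sup>2 + (max 0 y)\<^sup>2)" by (rule real_le_rsqrt) simp
    then show ?thesis by (simp add: divide_le_eq abs_divide not_sum_power2_lt_zero)
  qed
  from this[of "s - e"] this[of "- s - e"] show ?thesis
    unfolding trunc'_def by linarith
qed

lemma abs_trunc_le:
  assumes "e > 0" shows "\<bar>trunc e s\<bar> \<le> 2 * \<bar>s\<bar>"
proof -
  have "norm (trunc e s - trunc e 0) \<le> 2 * norm (s - 0)"
    by (rule field_differentiable_bound[of UNIV _ "trunc' e"])
      (auto simp: abs_trunc'_le has_real_derivative_trunc[OF assms])
  then show ?thesis using assms by (simp add: trunc_eq_0)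
qed

lemma tendsto_trunc:
  assumes "q \<longlonglongrightarrow> 0" shows "(\<lambda>k. trunc (q k) s) \<longlonglongrightarrow> s"
proof -
  have "(\<lambda>k. trunc (q k) s) \<longlonglongrightarrow> trunc 0 s"
    unfolding trunc_def by (intro tendsto_intros assms)
  \<comment> \<open>At e = 0 the two roots are the positive and the negative part of s.\<close>
  also have "trunc 0 s = s" by (auto simp: trunc_def max_def)
  finally show ?thesis .
qed

text \<open>The point s = 0 is a genuine exception, since \<open>trunc' (q k) 0 = 0\<close> for all
  k. This is why the gradient must be known to vanish almost everywhere on the zero set.\<close>

lemma tendsto_trunc':
  assumes "q \<longlonglongrightarrow> 0" "s \<noteq> 0" and q: "\<And>k. q k > 0"
  shows "(\<lambda>k. trunc' (q k) s) \<longlonglongrightarrow> 1"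
proof -
  have pos: "(\<lambda>k. trunc' (q k) y) \<longlonglongrightarrow> 1" if "y > 0" for y
  proof -
    have "(\<lambda>k. max 0 (y - q k) / sqrt ((q k)\<^sup>2 + (max 0 (y - q k))\<^sup>2))
        \<longlonglongrightarrow> max 0 (y - 0) / sqrt (0\<^sup>2 + (max 0 (y - 0))\<^sup>2)"
      using that by (intro tendsto_intros assms(1)) auto
    moreover have "max 0 (- y - q k) = 0" for k using that q[of k] by simp
    ultimately show ?thesis using that by (simp add: trunc'_def)
  qed
  have "trunc' e (- s) = trunc' e s" for e by (simp add: trunc'_def add.commute)
  then show ?thesis using pos[of s] pos[of "-s"] assms(2) by (cases "s > 0") auto
qed

lemma C1_approx_zero_boundary:
  fixes f :: "real^'n::finite \<Rightarrow> real"
  assumes U: "open U" "bounded U" and f: "C_k_on 2 U f"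
    and cont: "continuous_on (closure U) f" and bc: "\<And>x. x \<in> frontier U \<Longrightarrow> f x = 0"
    and L2: "f \<in> L2 U" "grad f \<in> L2 U"
  shows "C1_approx U f (grad f)"
proof -
  note f1 = C2_on_imp_C1_on[OF f]
  define q where "q k = inverse (real (Suc k))" for k
  have q: "q k > 0" for k by (simp add: q_def)
  have qlim: "q \<longlonglongrightarrow> 0" unfolding q_def by (rule LIMSEQ_inverse_real_of_nat)
  define g where "g k x = trunc (q k) (f x)" for k x
  have g1: "C_k_on 1 U (g k)" for k
    unfolding g_def by (rule C1_on_comp[OF U(1) f1 has_real_derivative_trunc[OF q] continuous_on_trunc'[OF q]])
  have gc: "C1c U (g k)" for k
    unfolding C1c_def
  proof (intro conjI exI)
    \<comment> \<open>Compact by continuity up to the boundary, and inside U because f is 0 on the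
      frontier while \<open>q k > 0\<close>.\<close>
    let ?K = "{x \<in> closure U. q k \<le> \<bar>f x\<bar>}"
    have "closed ?K"
      using continuous_closed_preimage[OF continuous_on_rabs[OF cont] closed_closure, of "{q k..}"]
      by (simp add: vimage_def Int_def)
    then show "compact ?K"
      using U(2) bounded_subset[of "closure U" ?K] by (auto simp: compact_eq_bounded_closed)
    show "?K \<subseteq> U"
      using bc U(1) q[of k] by (force simp: frontier_def interior_open)
    show "\<forall>x\<in>U - ?K. g k x = 0"
      using closure_subset[of U] by (auto simp: g_def intro!: trunc_eq_0)
  qed (rule g1)
  have grad_g: "grad (g k) x = trunc' (q k) (f x) *\<^sub>R grad f x" if "x \<in> U" for k x
    using partial_comp[OF C1_onD[OF f1 U(1) that] has_real_derivative_trunc[OF q[of k]]]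
    by (simp add: grad_def vec_eq_iff g_def[abs_def])
  have AE0: "AE x in lebesgue_on U. f x = 0 \<longrightarrow> grad f x = 0"
  proof -
    have "AE x in lebesgue. x \<notin> (\<Union>i. {x \<in> U. f x = 0 \<and> partial i f x \<noteq> 0})"
      using negligible_zero_partial_neq_0[OF U(1) f]
      by (intro AE_not_in) (simp add: negligible_iff_null_sets null_sets_UN countable_finite)
    then have "AE x in lebesgue. x \<in> U \<longrightarrow> f x = 0 \<longrightarrow> grad f x = 0"
      by eventually_elim (auto simp: grad_def vec_eq_iff)
    then show ?thesis using U(1) by (simp add: AE_restrict_space_iff)
  qed
  note mg = measurable_lebesgue_on_open[OF U(1) C1_on_continuous[OF g1]]
    and mgg = measurable_lebesgue_on_open[OF U(1) continuous_on_grad[OF g1]]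
  \<comment> \<open>Stated for a general codomain, since it is applied to the functions and to their
    gradients. From \<open>norm (u k x) \<le> 2 * norm (w x)\<close> the difference is at most 3
    times \<open>norm (w x)\<close>, whence the majorant with factor 9.\<close>
  have L2lim: "(\<lambda>k. L2_norm U (\<lambda>x. u k x - w x)) \<longlonglongrightarrow> 0"
    if u: "\<And>k. u k \<in> borel_measurable (lebesgue_on U)" and w: "w \<in> L2 U"
      and b: "\<And>k x. x \<in> U \<Longrightarrow> norm (u k x) \<le> 2 * norm (w x)"
      and l: "AE x in lebesgue_on U. (\<lambda>k. u k x) \<longlonglongrightarrow> w x"
    for u :: "nat \<Rightarrow> real^'n \<Rightarrow> 'b::euclidean_space" and w
  proof -
    have "(\<lambda>k. LINT x|lebesgue_on U. (norm (u k x - w x))\<^sup>2) \<longlonglongrightarrow> (LINT x|lebesgue_on U. 0)"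
    proof (rule integral_dominated_convergence)
      show "integrable (lebesgue_on U) (\<lambda>x. 9 * (norm (w x))\<^sup>2)"
        using w by (simp add: L2_def)
      show "(\<lambda>x. (norm (u k x - w x))\<^sup>2) \<in> borel_measurable (lebesgue_on U)" for k
        using u w by (auto simp: L2_def)
      show "AE x in lebesgue_on U. (\<lambda>k. (norm (u k x - w x))\<^sup>2) \<longlonglongrightarrow> 0"
        using l
      proof eventually_elim
        case (elim x)
        then have "(\<lambda>k. (norm (u k x - w x))\<^sup>2) \<longlonglongrightarrow> (norm (w x - w x))\<^sup>2"
          by (intro tendsto_intros)
        then show ?case by simp
      qed
      show "AE x in lebesgue_on U. norm ((norm (u k x - w x))\<^sup>2) \<le> 9 * (norm (w x))\<^sup>2" for k
      proof (rule AE_I2)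
        fix x assume "x \<in> space (lebesgue_on U)"
        then have "norm (u k x - w x) \<le> 3 * norm (w x)"
          using b[of x k] norm_triangle_ineq4[of "u k x" "w x"] by simp
        from power_mono[OF this, of 2] show "norm ((norm (u k x - w x))\<^sup>2) \<le> 9 * (norm (w x))\<^sup>2"
          by (simp add: power_mult_distrib)
      qed
    qed simp
    from tendsto_real_sqrt[OF this] show ?thesis by (simp add: L2_norm_def L2_inner_self)
  qed
  have "(\<lambda>k. L2_norm U (\<lambda>x. g k x - f x)) \<longlonglongrightarrow> 0"
    by (rule L2lim[OF mg L2(1)]) (auto simp: g_def abs_trunc_le q tendsto_trunc qlim)
  moreover have "(\<lambda>k. L2_norm U (\<lambda>x. grad (g k) x - grad f x)) \<longlonglongrightarrow> 0"
  proof (rule L2lim[OF mgg L2(2)])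
    show "norm (grad (g k) x) \<le> 2 * norm (grad f x)" if "x \<in> U" for k x
      using abs_trunc'_le[of "q k" "f x"] by (simp add: grad_g[OF that] mult_right_mono)
    have "AE x in lebesgue_on U. x \<in> U" by (rule AE_I2) simp
    with AE0 show "AE x in lebesgue_on U. (\<lambda>k. grad (g k) x) \<longlonglongrightarrow> grad f x"
    proof eventually_elim
      case (elim x)
      show ?case
      proof (cases "f x = 0")
        case False
        from tendsto_scaleR[OF tendsto_trunc'[OF qlim False q] tendsto_const[of "grad f x"]]
        show ?thesis by (simp add: grad_g[OF elim(2)])
      qed (use elim in \<open>simp add: grad_g\<close>)
    qed
  qed
  ultimately show ?thesis
    unfolding C1_approx_def using gc L2 by blast
qed

section \<open>Weak form and energy balance\<close>

lemma continuous_on_divergence: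
  assumes "\<And>i. C_k_on 1 U (\<lambda>x. u x $ i)"
  shows "continuous_on U (divergence u)"
  unfolding divergence_def using C1_on_continuous_partial[OF assms] by (intro continuous_on_sum)

text \<open>Time is frozen here: \<open>R\<close> is the expression that the second equation equates
  with (1 - a h) h_t, so it involves spatial derivatives only.\<close>

lemma weak_continuity_equation:
  fixes v :: "real^'n::finite \<Rightarrow> real^'n" and b c d :: real
  assumes U: "open U" and v: "\<And>i. C_k_on 1 U (\<lambda>x. v x $ i)" and h: "C_k_on 2 U h"
    and bv: "\<And>x. x \<in> U \<Longrightarrow> norm (v x) \<le> M" and bh: "\<And>x. x \<in> U \<Longrightarrow> \<bar>h x\<bar> \<le> M"
    and L2: "v \<in> L2 U" "grad h \<in> L2 U" "divergence v \<in> L2 U" "laplacian h \<in> L2 U"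
  defines "R \<equiv> (\<lambda>x. b * laplacian h x - c * (v x \<bullet> grad h x) - d * h x * divergence v x - divergence v x)"
  shows "R \<in> L2 U"
    and "C1_approx U q Dq \<Longrightarrow> L2_inner U R q - L2_inner U v Dq
              = - b * L2_inner U (grad h) Dq - (c - d) * L2_inner U (\<lambda>x. v x \<bullet> grad h x) q
                + d * L2_inner U h (\<lambda>x. v x \<bullet> Dq x)"
proof -
  note h1 = C2_on_imp_C1_on[OF h]
  note mh = measurable_lebesgue_on_open[OF U C1_on_continuous[OF h1]]
  have [measurable]: "v \<in> borel_measurable (lebesgue_on U)" "grad h \<in> borel_measurable (lebesgue_on U)"
    using L2 by (auto simp: L2_def)
  have vg: "(\<lambda>x. v x \<bullet> grad h x) \<in> L2 U"
  proof (rule L2_dominated[where C = M, OF _ L2(2)])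
    show "norm (v x \<bullet> grad h x) \<le> M * norm (grad h x)" if "x \<in> U" for x
      using Cauchy_Schwarz_ineq2[of "v x" "grad h x"] mult_right_mono[OF bv[OF that] norm_ge_zero[of "grad h x"]]
      by simp
  qed measurable
  have hd: "(\<lambda>x. h x * divergence v x) \<in> L2 U"
    using L2_bounded_scaleR[OF L2(3) mh bh] by simp
  have hv: "(\<lambda>x. h x *\<^sub>R v x) \<in> L2 U"
    by (rule L2_bounded_scaleR[OF L2(1) mh bh])
  have s: "(\<lambda>x. r * f x) \<in> L2 U" if "f \<in> L2 U" for r and f :: "real^'n \<Rightarrow> real"
    using L2_scaleR[OF that] by simp
  have R_eq: "R = (\<lambda>x. b * laplacian h x - c * (v x \<bullet> grad h x) - d * (h x * divergence v x) - divergence v x)"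
    by (simp add: R_def mult.assoc)
  show "R \<in> L2 U" unfolding R_eq by (intro L2_diff s L2 vg hd)
  have div_hv: "divergence (\<lambda>x. h x *\<^sub>R v x) x = h x * divergence v x + v x \<bullet> grad h x" if "x \<in> U" for x
    by (rule divergence_scaleR[OF C1_onD[OF h1 U that] C1_onD[OF v U that]])
  have C1_hv: "C_k_on 1 U (\<lambda>x. (h x *\<^sub>R v x) $ i)" for i
    using C1_on_mult[OF U h1 v] by simp
  \<comment> \<open>The product rule holds on U only, so it supplies the bound, while measurability
    comes from continuity on U.\<close>
  have div_hv_L2: "divergence (\<lambda>x. h x *\<^sub>R v x) \<in> L2 U"
    by (rule L2_dominated[where C = 1, OF measurable_lebesgue_on_open[OF U continuous_on_divergence[OF C1_hv]]
          L2_add[OF hd vg]]) (simp add: div_hv)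
  assume q: "C1_approx U q Dq"
  then have q2: "q \<in> L2 U" by (simp add: C1_approx_def)
  have I1: "L2_inner U (divergence v) q = - L2_inner U v Dq"
    by (rule divergence_theorem_C1_approx[OF U v L2(1,3) q])
  have "L2_inner U (divergence (grad h)) q = - L2_inner U (grad h) Dq"
    by (rule divergence_theorem_C1_approx[OF U _ L2(2) _ q])
      (use C2_on_partial[OF h] L2(4) in \<open>simp_all add: grad_def divergence_grad[abs_def]\<close>)
  then have I2: "L2_inner U (laplacian h) q = - L2_inner U (grad h) Dq"
    by (simp add: divergence_grad[abs_def])
  have "L2_inner U (\<lambda>x. h x * divergence v x) q + L2_inner U (\<lambda>x. v x \<bullet> grad h x) q
      = (LINT x|lebesgue_on U. (h x * divergence v x) \<bullet> q x + (v x \<bullet> grad h x) \<bullet> q x)"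
    unfolding L2_inner_def
    by (rule Bochner_Integration.integral_add[symmetric]) (intro integrable_L2_inner hd vg q2)+
  also have "\<dots> = L2_inner U (divergence (\<lambda>x. h x *\<^sub>R v x)) q"
    unfolding L2_inner_def
    by (rule Bochner_Integration.integral_cong) (auto simp: div_hv distrib_right)
  also have "\<dots> = - L2_inner U (\<lambda>x. h x *\<^sub>R v x) Dq"
    by (rule divergence_theorem_C1_approx[OF U C1_hv hv div_hv_L2 q])
  also have "\<dots> = - L2_inner U h (\<lambda>x. v x \<bullet> Dq x)"
    by (simp add: L2_inner_def)
  finally have I3: "L2_inner U (\<lambda>x. h x * divergence v x) q
      = - L2_inner U h (\<lambda>x. v x \<bullet> Dq x) - L2_inner U (\<lambda>x. v x \<bullet> grad h x) q" by simp
  have "L2_inner U R q = (LINT x|lebesgue_on U. b * (laplacian h x \<bullet> q x) - c * ((v x \<bullet> grad h x) \<bullet> q x)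
      - d * ((h x * divergence v x) \<bullet> q x) - divergence v x \<bullet> q x)"
    unfolding L2_inner_def R_eq
    by (rule Bochner_Integration.integral_cong) (auto simp: algebra_simps)
  also have "\<dots> = b * L2_inner U (laplacian h) q - c * L2_inner U (\<lambda>x. v x \<bullet> grad h x) q
      - d * L2_inner U (\<lambda>x. h x * divergence v x) q - L2_inner U (divergence v) q"
    using integrable_L2_inner[OF L2(4) q2] integrable_L2_inner[OF vg q2]
      integrable_L2_inner[OF hd q2] integrable_L2_inner[OF L2(3) q2]
    by (simp add: L2_inner_def del: inner_real_def)
  finally show "L2_inner U R q - L2_inner U v Dq
              = - b * L2_inner U (grad h) Dq - (c - d) * L2_inner U (\<lambda>x. v x \<bullet> grad h x) q
                + d * L2_inner U h (\<lambda>x. v x \<bullet> Dq x)"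
    unfolding I1 I2 I3 by (simp add: algebra_simps)
qed

section \<open>Differentiation of the energy under the integral and its monotonicity\<close>

lemma has_real_derivative_integral:
  fixes f f' :: "real \<Rightarrow> 'a \<Rightarrow> real"
  assumes I: "convex I" "t \<in> I"
    and int: "\<And>s. s \<in> I \<Longrightarrow> integrable M (f s)"
    and der: "\<And>s x. s \<in> I \<Longrightarrow> x \<in> space M \<Longrightarrow>
        ((\<lambda>s. f s x) has_real_derivative f' s x) (at s within I)"
    and bound: "\<And>s x. s \<in> I \<Longrightarrow> x \<in> space M \<Longrightarrow> \<bar>f' s x\<bar> \<le> B x" and B: "integrable M B"
    and meas: "f' t \<in> borel_measurable M"
  shows "((\<lambda>s. integral\<^sup>L M (f s)) has_real_derivative integral\<^sup>L M (f' t)) (at t within I)"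
  unfolding has_field_derivative_iff tendsto_at_iff_sequentially
proof (intro allI impI)
  fix X :: "nat \<Rightarrow> real" assume X: "\<forall>k. X k \<in> I - {t}" "X \<longlonglongrightarrow> t"
  define D where "D k x = (f (X k) x - f t x) / (X k - t)" for k x
  have XI: "X k \<in> I" "X k \<noteq> t" for k using X(1) by auto
  have "(\<lambda>k. integral\<^sup>L M (D k)) \<longlonglongrightarrow> integral\<^sup>L M (f' t)"
  proof (rule integral_dominated_convergence[OF meas _ B])
    show "D k \<in> borel_measurable M" for k
      unfolding D_def using int[OF XI(1)[of k]] int[OF I(2)]
      by (intro borel_measurable_divide borel_measurable_diff borel_measurable_const borel_measurable_integrable)
    show "AE x in M. (\<lambda>k. D k x) \<longlonglongrightarrow> f' t x"
    proof (rule AE_I2)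
      fix x assume "x \<in> space M"
      from der[OF I(2) this, unfolded has_field_derivative_iff tendsto_at_iff_sequentially] X
      show "(\<lambda>k. D k x) \<longlonglongrightarrow> f' t x" by (simp add: D_def comp_def)
    qed
    show "AE x in M. norm (D k x) \<le> B x" for k
    proof (rule AE_I2)
      fix x assume x: "x \<in> space M"
      \<comment> \<open>The mean value inequality along the interval: the bound on
        \<open>f' s x\<close> for every s in I becomes a bound on the difference quotients at
        t.\<close>
      have "norm (f (X k) x - f t x) \<le> B x * norm (X k - t)"
        by (rule field_differentiable_bound[OF I(1) der[OF _ x]]) (use bound x XI(1) I in auto)
      then show "norm (D k x) \<le> B x"
        using XI(2)[of k] by (simp add: D_def divide_le_eq)
    qed
  qed
  then show "((\<lambda>y. (integral\<^sup>L M (f y) - integral\<^sup>L M (f t)) / (y - t)) \<circ> X) \<longlonglongrightarrow> integral\<^sup>L M (f' t)"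
    by (simp add: comp_def D_def[abs_def] int XI(1) I(2))
qed

lemma has_real_derivative_energy_density:
  fixes v :: "real \<Rightarrow> 'a::real_inner" and h :: "real \<Rightarrow> real"
  assumes v: "(v has_vector_derivative v') (at t within S)"
    and h: "(h has_real_derivative h') (at t within S)"
  shows "((\<lambda>s. 1/2 * (norm (v s))\<^sup>2 + 1/2 * (h s)\<^sup>2 - a/3 * (h s)^3) has_real_derivative
      v t \<bullet> v' + h t * h' - a * (h t)\<^sup>2 * h') (at t within S)"
proof -
  have "((\<lambda>s. v s \<bullet> v s) has_derivative (\<lambda>r. v t \<bullet> (r *\<^sub>R v') + (r *\<^sub>R v') \<bullet> v t)) (at t within S)"
    by (rule has_derivative_inner[OF v[unfolded has_vector_derivative_def] v[unfolded has_vector_derivative_def]])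
  moreover have "(\<lambda>r. v t \<bullet> (r *\<^sub>R v') + (r *\<^sub>R v') \<bullet> v t) = (*) (2 * (v t \<bullet> v'))"
    by (auto simp: inner_commute)
  ultimately have "((\<lambda>s. (norm (v s))\<^sup>2) has_real_derivative 2 * (v t \<bullet> v')) (at t within S)"
    by (simp add: has_field_derivative_def power2_norm_eq_inner)
  from DERIV_cmult[OF this, of "1/2"]
  have "((\<lambda>s. 1/2 * (norm (v s))\<^sup>2) has_real_derivative v t \<bullet> v') (at t within S)" by simp
  moreover have "((\<lambda>s. 1/2 * (h s)\<^sup>2 - a/3 * (h s)^3) has_real_derivative
      h t * h' - a * (h t)\<^sup>2 * h') (at t within S)"
    by (auto intro!: derivative_eq_intros h simp: field_simps power2_eq_square)
  ultimately have "((\<lambda>s. 1/2 * (norm (v s))\<^sup>2 + (1/2 * (h s)\<^sup>2 - a/3 * (h s)^3)) has_real_derivative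
      v t \<bullet> v' + (h t * h' - a * (h t)\<^sup>2 * h')) (at t within S)"
    by (rule DERIV_add)
  then show ?thesis by (simp add: algebra_simps)
qed

lemma antimono_on_interval_deriv_nonpos:
  fixes f :: "real \<Rightarrow> real"
  assumes der: "\<And>t. t \<in> {a..b} \<Longrightarrow> (f has_real_derivative f' t) (at t within {a..b})"
    and le: "\<And>t. t \<in> {a..b} \<Longrightarrow> f' t \<le> 0"
  shows "antimono_on {a..b} f"
proof (rule monotone_onI)
  fix x y assume xy: "x \<in> {a..b}" "y \<in> {a..b}" "x \<le> y"
  show "f y \<le> f x"
  proof (cases "x = y")
    case False
    then have "\<exists>z\<in>{x<..<y}. f y - f x = f' z * (y - x)"
      using xy by (intro mvt_simple)
        (auto intro!: has_derivative_subset[OF der[unfolded has_field_derivative_def]])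
    then obtain z where "z \<in> {x<..<y}" "f y - f x = f' z * (y - x)" by blast
    moreover from this xy have "f' z * (y - x) \<le> 0"
      by (intro mult_nonpos_nonneg le) auto
    ultimately show ?thesis by simp
  qed simp
qed

theorem proposition1:
  fixes \<Omega> :: "(real^'n::finite) set"
    and a b c d T :: real
    and v :: "real \<Rightarrow> real^'n \<Rightarrow> real^'n" and h :: "real \<Rightarrow> real^'n \<Rightarrow> real"
    and v0 :: "real^'n \<Rightarrow> real^'n" and h0 :: "real^'n \<Rightarrow> real"
  assumes dim: "CARD('n) \<le> 3"
    and dom: "bounded_domain \<Omega>" and bdry: "C_k1_boundary 3 \<Omega>"
    and params: "a \<ge> 0" "c \<ge> 0" "d \<ge> 0" "b > 0" "T > 0"
    and smooth: "sufficiently_smooth \<Omega> T v h"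
    and eq_v: "\<And>t x. t \<in> {0..T} \<Longrightarrow> x \<in> \<Omega> \<Longrightarrow> time_deriv T v t x + grad (h t) x = 0"
    and eq_h: "\<And>t x. t \<in> {0..T} \<Longrightarrow> x \<in> \<Omega> \<Longrightarrow>
        (1 - a * h t x) * time_deriv T h t x + divergence (v t) x
          = b * laplacian (h t) x - c * (v t x \<bullet> grad (h t) x) - d * h t x * divergence (v t) x"
    and bc: "\<And>t x. t \<in> {0..T} \<Longrightarrow> x \<in> frontier \<Omega> \<Longrightarrow> h t x = 0"
    and ic_h: "\<And>x. x \<in> \<Omega> \<Longrightarrow> h 0 x = h0 x" and ic_v: "\<And>x. x \<in> \<Omega> \<Longrightarrow> v 0 x = v0 x"
  shows "(\<forall>w\<in>L2 \<Omega>. \<forall>q Dq. H10 \<Omega> q Dq \<longrightarrow> (\<forall>t\<in>{0..T}.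
            L2_inner \<Omega> (time_deriv T v t) w + L2_inner \<Omega> (grad (h t)) w = 0
          \<and> L2_inner \<Omega> (\<lambda>x. (1 - a * h t x) * time_deriv T h t x) q - L2_inner \<Omega> (v t) Dq
              = - b * L2_inner \<Omega> (grad (h t)) Dq
                - (c - d) * L2_inner \<Omega> (\<lambda>x. v t x \<bullet> grad (h t) x) q
                + d * L2_inner \<Omega> (h t) (\<lambda>x. v t x \<bullet> Dq x)))
       \<and> (\<forall>t\<in>{0..T}.
            ((\<lambda>s. hamiltonian \<Omega> a (v s) (h s)) has_real_derivative
               - b * (L2_norm \<Omega> (grad (h t)))\<^sup>2
               + (2 * d - c) * L2_inner \<Omega> (\<lambda>x. v t x \<bullet> grad (h t) x) (h t))
            (at t within {0..T}))
       \<and> (c = 2 * d \<longrightarrow> antimono_on {0..T} (\<lambda>t. hamiltonian \<Omega> a (v t) (h t)))"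
proof -
  have U: "open \<Omega>" "bounded \<Omega>" using dom by (auto simp: bounded_domain_def)
  have contv: "continuous_on ({0..T} \<times> closure \<Omega>) (\<lambda>(t, x). v t x)"
    and conth: "continuous_on ({0..T} \<times> closure \<Omega>) (\<lambda>(t, x). h t x)"
    using smooth unfolding sufficiently_smooth_def by blast+
  have v1: "C_k_on 1 \<Omega> (\<lambda>x. v t x $ i)" and h2: "C_k_on 2 \<Omega> (h t)" if "t \<in> {0..T}" for t i
    using smooth that unfolding sufficiently_smooth_def by blast+
  have dv: "(\<lambda>s. v s x) differentiable (at t within {0..T})"
    and dh: "(\<lambda>s. h s x) differentiable (at t within {0..T})" if "t \<in> {0..T}" "x \<in> \<Omega>" for t x
    using smooth that unfolding sufficiently_smooth_def by blast+
  obtain G where G: "G \<in> L2 \<Omega>"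
    and Gb: "\<And>t x. t \<in> {0..T} \<Longrightarrow> x \<in> \<Omega> \<Longrightarrow> norm (time_deriv T v t x) \<le> G x"
      "\<And>t x. t \<in> {0..T} \<Longrightarrow> x \<in> \<Omega> \<Longrightarrow> \<bar>time_deriv T h t x\<bar> \<le> G x"
      "\<And>t x. t \<in> {0..T} \<Longrightarrow> x \<in> \<Omega> \<Longrightarrow> norm (grad (h t) x) \<le> G x"
      "\<And>t x. t \<in> {0..T} \<Longrightarrow> x \<in> \<Omega> \<Longrightarrow> \<bar>divergence (v t) x\<bar> \<le> G x"
      "\<And>t x. t \<in> {0..T} \<Longrightarrow> x \<in> \<Omega> \<Longrightarrow> \<bar>laplacian (h t) x\<bar> \<le> G x"
    using smooth unfolding sufficiently_smooth_def by blast
  \<comment> \<open>Joint continuity on this compact set yields bounds for v and h that are uniform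
    in time as well as in space.\<close>
  have compact: "compact ({0..T} \<times> closure \<Omega>)"
    using U by (simp add: compact_Times)
  obtain Mv where Mv: "\<And>t x. t \<in> {0..T} \<Longrightarrow> x \<in> closure \<Omega> \<Longrightarrow> norm (v t x) \<le> Mv"
    using compact_imp_bounded[OF compact_continuous_image[OF contv compact]]
    by (force simp: bounded_iff)
  obtain Mh where Mh: "\<And>t x. t \<in> {0..T} \<Longrightarrow> x \<in> closure \<Omega> \<Longrightarrow> \<bar>h t x\<bar> \<le> Mh"
    using compact_imp_bounded[OF compact_continuous_image[OF conth compact]]
    by (force simp: bounded_iff)
  define M where "M = max Mv Mh"
  have clos: "x \<in> closure \<Omega>" if "x \<in> \<Omega>" for x using that closure_subset by blast
  have bv: "norm (v t x) \<le> M" and bh: "\<bar>h t x\<bar> \<le> M" if "t \<in> {0..T}" "x \<in> \<Omega>" for t x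
    using Mv[OF that(1) clos[OF that(2)]] Mh[OF that(1) clos[OF that(2)]] by (auto simp: M_def)
  have ct: "continuous_on (closure \<Omega>) (v t)" "continuous_on (closure \<Omega>) (h t)" if "t \<in> {0..T}" for t
  proof -
    have "continuous_on (closure \<Omega>) (\<lambda>x. (t, x))" "(\<lambda>x. (t, x)) ` closure \<Omega> \<subseteq> {0..T} \<times> closure \<Omega>"
      using that by (auto intro!: continuous_intros)
    from continuous_on_compose2[OF contv this] continuous_on_compose2[OF conth this]
    show "continuous_on (closure \<Omega>) (v t)" "continuous_on (closure \<Omega>) (h t)" by simp_all
  qed
  have mv: "v t \<in> borel_measurable (lebesgue_on \<Omega>)" and mh: "h t \<in> borel_measurable (lebesgue_on \<Omega>)"
    if "t \<in> {0..T}" for t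
    using ct[OF that] closure_subset U(1)
    by (auto intro!: measurable_lebesgue_on_open intro: continuous_on_subset)
  have fin: "finite_measure (lebesgue_on \<Omega>)"
    using U by (intro finite_measure_lebesgue_on) (auto intro: lmeasurable_open)
  interpret finite_measure "lebesgue_on \<Omega>" by (rule fin)
  \<comment> \<open>On a set of finite measure, pairing with 1 makes the majorant G integrable, and
    comparison with 1 puts bounded measurable functions into \<open>L\<^sup>2\<close>.\<close>
  have one: "(\<lambda>x. 1 :: real) \<in> L2 \<Omega>" by (simp add: L2_def)
  have intG: "integrable (lebesgue_on \<Omega>) G"
    using integrable_L2_inner[OF G one] by simp
  have L2_bdd: "f \<in> L2 \<Omega>" if "f \<in> borel_measurable (lebesgue_on \<Omega>)" "\<And>x. x \<in> \<Omega> \<Longrightarrow> norm (f x) \<le> M"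
    for f :: "real^'n \<Rightarrow> 'b::euclidean_space"
    by (rule L2_dominated[where C = M, OF that(1) one]) (simp add: that(2))
  have L2_G: "f \<in> L2 \<Omega>" if "continuous_on \<Omega> f" "\<And>x. x \<in> \<Omega> \<Longrightarrow> norm (f x) \<le> G x"
    for f :: "real^'n \<Rightarrow> 'b::euclidean_space"
    by (rule L2_dominated[where C = 1, OF measurable_lebesgue_on_open[OF U(1) that(1)] G])
      (use that(2) in force)
  have Lv: "v t \<in> L2 \<Omega>" and Lh: "h t \<in> L2 \<Omega>" if "t \<in> {0..T}" for t
    using that by (auto intro!: L2_bdd mv mh bv bh)
  have Lg: "grad (h t) \<in> L2 \<Omega>" and Ld: "divergence (v t) \<in> L2 \<Omega>" and Ll: "laplacian (h t) \<in> L2 \<Omega>"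
    if t: "t \<in> {0..T}" for t
  proof -
    show "grad (h t) \<in> L2 \<Omega>"
      by (rule L2_G[OF continuous_on_grad[OF C2_on_imp_C1_on[OF h2[OF t]]] Gb(3)[OF t]])
    show "divergence (v t) \<in> L2 \<Omega>"
      by (rule L2_G[OF continuous_on_divergence[OF v1[OF t]]]) (simp add: Gb(4)[OF t])
    have "C_k_on 1 \<Omega> (\<lambda>x. grad (h t) x $ i)" for i
      using C2_on_partial[OF h2[OF t]] by (simp add: grad_def)
    from continuous_on_divergence[OF this] show "laplacian (h t) \<in> L2 \<Omega>"
      by (intro L2_G) (simp_all add: divergence_grad[abs_def] Gb(5)[OF t])
  qed
  define R where "R t x = b * laplacian (h t) x - c * (v t x \<bullet> grad (h t) x)
    - d * h t x * divergence (v t) x - divergence (v t) x" for t x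
  have R: "(1 - a * h t x) * time_deriv T h t x = R t x" if "t \<in> {0..T}" "x \<in> \<Omega>" for t x
    using eq_h[OF that] by (simp add: R_def)
  have R_L2: "R t \<in> L2 \<Omega>"
    and weak: "C1_approx \<Omega> q Dq \<Longrightarrow> L2_inner \<Omega> (R t) q - L2_inner \<Omega> (v t) Dq
              = - b * L2_inner \<Omega> (grad (h t)) Dq
                - (c - d) * L2_inner \<Omega> (\<lambda>x. v t x \<bullet> grad (h t) x) q
                + d * L2_inner \<Omega> (h t) (\<lambda>x. v t x \<bullet> Dq x)"
    if t: "t \<in> {0..T}" for t q Dq
    unfolding R_def[abs_def]
    by (rule weak_continuity_equation[OF U(1) v1[OF t] h2[OF t] bv[OF t] bh[OF t]
          Lv[OF t] Lg[OF t] Ld[OF t] Ll[OF t]], assumption+)+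
  have vt: "time_deriv T v t x = - grad (h t) x" if "t \<in> {0..T}" "x \<in> \<Omega>" for t x
    using eq_v[OF that] by (simp add: eq_neg_iff_add_eq_0)
  have part1: "L2_inner \<Omega> (time_deriv T v t) w + L2_inner \<Omega> (grad (h t)) w = 0" if t: "t \<in> {0..T}" for t w
  proof -
    have "L2_inner \<Omega> (time_deriv T v t) w = (LINT x|lebesgue_on \<Omega>. - (grad (h t) x \<bullet> w x))"
      unfolding L2_inner_def by (rule Bochner_Integration.integral_cong) (auto simp: vt[OF t])
    then show ?thesis by (simp add: L2_inner_def)
  qed
  have part2: "L2_inner \<Omega> (\<lambda>x. (1 - a * h t x) * time_deriv T h t x) q - L2_inner \<Omega> (v t) Dq
              = - b * L2_inner \<Omega> (grad (h t)) Dq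
                - (c - d) * L2_inner \<Omega> (\<lambda>x. v t x \<bullet> grad (h t) x) q
                + d * L2_inner \<Omega> (h t) (\<lambda>x. v t x \<bullet> Dq x)"
    if t: "t \<in> {0..T}" and q: "C1_approx \<Omega> q Dq" for t q Dq
  proof -
    have "L2_inner \<Omega> (\<lambda>x. (1 - a * h t x) * time_deriv T h t x) q = L2_inner \<Omega> (R t) q"
      unfolding L2_inner_def by (rule Bochner_Integration.integral_cong) (auto simp: R[OF t])
    then show ?thesis using weak[OF t q] by simp
  qed
  define E where "E t x = v t x \<bullet> time_deriv T v t x + h t x * time_deriv T h t x
      - a * (h t x)\<^sup>2 * time_deriv T h t x" for t x
  \<comment> \<open>The quadratic and cubic terms in h combine to (1 - a h) h_t h, which is R h, and
    v_t is replaced by - grad h. No time derivative is left.\<close>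
  have E_eq: "E t x = R t x * h t x - v t x \<bullet> grad (h t) x" if "t \<in> {0..T}" "x \<in> \<Omega>" for t x
    by (simp add: E_def vt[OF that] R[OF that, symmetric] power2_eq_square algebra_simps)
  have part3: "((\<lambda>s. hamiltonian \<Omega> a (v s) (h s)) has_real_derivative
               - b * (L2_norm \<Omega> (grad (h t)))\<^sup>2
               + (2 * d - c) * L2_inner \<Omega> (\<lambda>x. v t x \<bullet> grad (h t) x) (h t)) (at t within {0..T})"
    if t: "t \<in> {0..T}" for t
  proof -
    have int: "integrable (lebesgue_on \<Omega>) (\<lambda>x. R t x * h t x - v t x \<bullet> grad (h t) x)"
      using integrable_L2_inner[OF R_L2[OF t] Lh[OF t]] integrable_L2_inner[OF Lv[OF t] Lg[OF t]] by simp
    have "C1_approx \<Omega> (h t) (grad (h t))"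
      by (rule C1_approx_zero_boundary[OF U h2[OF t] ct(2)[OF t] bc[OF t] Lh[OF t] Lg[OF t]])
    \<comment> \<open>With q = h the integrals weighted by -(c - d) and by d coincide, and the
      weights add up to 2d - c.\<close>
    from weak[OF t this]
    have "L2_inner \<Omega> (R t) (h t) - L2_inner \<Omega> (v t) (grad (h t)) =
        - b * (L2_norm \<Omega> (grad (h t)))\<^sup>2 + (2 * d - c) * L2_inner \<Omega> (\<lambda>x. v t x \<bullet> grad (h t) x) (h t)"
      by (simp add: L2_norm_square L2_inner_def mult.commute algebra_simps)
    moreover have "integral\<^sup>L (lebesgue_on \<Omega>) (E t)
        = (LINT x|lebesgue_on \<Omega>. R t x * h t x - v t x \<bullet> grad (h t) x)"
      by (rule Bochner_Integration.integral_cong) (auto simp: E_eq[OF t])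
    moreover have "\<dots> = L2_inner \<Omega> (R t) (h t) - L2_inner \<Omega> (v t) (grad (h t))"
      using integrable_L2_inner[OF R_L2[OF t] Lh[OF t]] integrable_L2_inner[OF Lv[OF t] Lg[OF t]]
      by (simp add: L2_inner_def)
    moreover have "((\<lambda>s. hamiltonian \<Omega> a (v s) (h s)) has_real_derivative
        integral\<^sup>L (lebesgue_on \<Omega>) (E t)) (at t within {0..T})"
      unfolding hamiltonian_def
    proof (rule has_real_derivative_integral[OF _ t])
      show "integrable (lebesgue_on \<Omega>) (\<lambda>x. 1/2 * (norm (v s x))\<^sup>2 + 1/2 * (h s x)\<^sup>2 - a/3 * (h s x)^3)"
        if s: "s \<in> {0..T}" for s
      proof -
        have "integrable (lebesgue_on \<Omega>) (\<lambda>x. (h s x)^3)"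
        proof (rule integrable_const_bound[of _ "M^3"])
          show "AE x in lebesgue_on \<Omega>. norm ((h s x)^3) \<le> M^3"
            using bh[OF s] by (intro AE_I2) (auto simp: power_abs intro!: power_mono)
        qed (use mh[OF s] in measurable)
        then show ?thesis using Lv[OF s] Lh[OF s] by (simp add: L2_def)
      qed
      show "((\<lambda>s. 1/2 * (norm (v s x))\<^sup>2 + 1/2 * (h s x)\<^sup>2 - a/3 * (h s x)^3) has_real_derivative E s x)
          (at s within {0..T})" if s: "s \<in> {0..T}" and "x \<in> space (lebesgue_on \<Omega>)" for s x
      proof -
        have x: "x \<in> \<Omega>" using that by simp
        show ?thesis unfolding E_def
        proof (rule has_real_derivative_energy_density)
          show "((\<lambda>s. v s x) has_vector_derivative time_deriv T v s x) (at s within {0..T})"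
            using dv[OF s x] unfolding time_deriv_def by (simp add: vector_derivative_works)
          show "((\<lambda>s. h s x) has_real_derivative time_deriv T h s x) (at s within {0..T})"
            using dh[OF s x] unfolding time_deriv_def has_real_derivative_iff_has_vector_derivative
            by (simp add: vector_derivative_works)
        qed
      qed
      \<comment> \<open>One coefficient for each term of E: M bounds v and h, and G bounds the time
        derivative.\<close>
      show "integrable (lebesgue_on \<Omega>) (\<lambda>x. (M + M + a * M\<^sup>2) * G x)" using intG by simp
      show "\<bar>E s x\<bar> \<le> (M + M + a * M\<^sup>2) * G x" if s: "s \<in> {0..T}" and "x \<in> space (lebesgue_on \<Omega>)" for s x
      proof -
        have x: "x \<in> \<Omega>" using that by simp
        have M: "0 \<le> M" using bh[OF s x] by linarith
        have 1: "\<bar>v s x \<bullet> time_deriv T v s x\<bar> \<le> M * G x"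
          by (rule order_trans[OF Cauchy_Schwarz_ineq2 mult_mono[OF bv[OF s x] Gb(1)[OF s x] M norm_ge_zero]])
        have 2: "\<bar>h s x * time_deriv T h s x\<bar> \<le> M * G x"
          unfolding abs_mult by (rule mult_mono[OF bh[OF s x] Gb(2)[OF s x] M abs_ge_zero])
        have "\<bar>h s x\<bar>\<^sup>2 \<le> M\<^sup>2" using bh[OF s x] by (intro power_mono) auto
        then have 3: "\<bar>a * (h s x)\<^sup>2 * time_deriv T h s x\<bar> \<le> a * M\<^sup>2 * G x"
          unfolding abs_mult using params(1) Gb(2)[OF s x] by (intro mult_mono) auto
        show ?thesis
          using 1 2 3 unfolding E_def distrib_right by linarith
      qed
      \<comment> \<open>Measurability of E is read off its spatial form, so the time derivatives are
        not treated as measurable functions in their own right.\<close>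
      have "(\<lambda>x. R t x * h t x - v t x \<bullet> grad (h t) x) \<in> borel_measurable (lebesgue_on \<Omega>)"
        using int by (rule borel_measurable_integrable)
      also have "?this \<longleftrightarrow> E t \<in> borel_measurable (lebesgue_on \<Omega>)"
        by (rule measurable_cong) (simp add: E_eq[OF t])
      finally show "E t \<in> borel_measurable (lebesgue_on \<Omega>)" .
    qed simp
    ultimately show ?thesis by simp
  qed
  have part4: "antimono_on {0..T} (\<lambda>t. hamiltonian \<Omega> a (v t) (h t))" if "c = 2 * d"
    by (rule antimono_on_interval_deriv_nonpos[OF part3]) (use that params in auto)
  show ?thesis
    using part1 part2[OF _ H10_imp_C1_approx] part3 part4 by blast
qed

end
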